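(* Let $c\in\mathbb{C}$ with $c\neq 0$. Then the maximal proper submodule $J(c,0,0)$ of the Verma module $V(c,0,0)$ for $W(2,2)$ is $$J(c,0,0)=U(W(2,2))L_{-1}1+U(W(2,2))W_{-1}1,$$ and the irreducible module $L(c,0,0)=V(c,0,0)/J(c,0,0)$ has basis $$S=\{W_{-m_1}\cdots W_{-m_s}L_{-n_1}\cdots L_{-n_t}\mathbf{1}\mid m_1\geq\cdots\geq m_s>1,\ n_1\geq\cdots\geq n_t>1\}$$ (with $s,t\ge 0$ and all $m_i,n_j$ integers), where $\mathbf{1}$ is the canonical highest weight vector of $L(c,0,0)$.
   Context: $W(2,2)$ is the complex Lie algebra with basis $L_m, W_m$ ($m\in\mathbb{Z}$), $C$, and bracket $[L_m,L_n]=(m-n)L_{m+n}+\frac{m^3-m}{12}\delta_{m+n,0}C$, $[L_m,W_n]=(m-n)W_{m+n}+\frac{m^3-m}{12}\delta_{m+n,0}C$, $[W_m,W_n]=0$, with $C$ central. $U(W(2,2))$ is its universal enveloping algebra. For $c,h_1,h_2\in\mathbb{C}$, the Verma module is $V(c,h_1,h_2)=U(W(2,2))/I_{c,h_1,h_2}$, where $I_{c,h_1,h_2}$ is the left ideal generated by $L_m,W_m$ ($m>0$), $C-c$, $L_0-h_1$, $W_0-h_2$. The element $1=1+I_{c,h_1,h_2}$ is its canonical highest weight vector. $V(c,h_1,h_2)$ has a unique maximal proper submodule $J(c,h_1,h_2)$, and $L(c,h_1,h_2)=V(c,h_1,h_2)/J(c,h_1,h_2)$ is the irreducible quotient; its canonical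 highest weight vector $\mathbf 1$ is the image of $1$. *)

theory Defs
  imports
    "HOL-Library.Poly_Mapping"
    "HOL-Algebra.QuotRing"
    "Jordan_Normal_Form.VS_Connect"
begin

hide_const (open) Multiset.mult Polynomial.smult Modules.module

text \<open>
  A complex vector space with basis indexed by a type \<open>'b\<close> is represented by the finitely
  supported functions \<open>'b \<Rightarrow>\<^sub>0 complex\<close>; the basis vector of index \<open>b\<close> is \<open>Poly_Mapping.single b 1\<close>.
\<close>

definition scale :: "complex \<Rightarrow> ('b \<Rightarrow>\<^sub>0 complex) \<Rightarrow> ('b \<Rightarrow>\<^sub>0 complex)"
  where "scale z p = Poly_Mapping.map ((*) z) p"

definition bilinear_ext ::
    "('a \<Rightarrow> 'b \<Rightarrow> 'd \<Rightarrow>\<^sub>0 complex) \<Rightarrow> ('a \<Rightarrow>\<^sub>0 complex) \<Rightarrow> ('b \<Rightarrow>\<^sub>0 complex) \<Rightarrow> ('d \<Rightarrow>\<^sub>0 complex)"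
  where "bilinear_ext f x y =
    (\<Sum>a\<in>Poly_Mapping.keys x. \<Sum>b\<in>Poly_Mapping.keys y.
       scale (Poly_Mapping.lookup x a * Poly_Mapping.lookup y b) (f a b))"


section \<open>The Lie algebra W(2,2)\<close>

datatype w22_basis = L int | W int | C

type_synonym w22 = "w22_basis \<Rightarrow>\<^sub>0 complex"

definition w22_central :: "int \<Rightarrow> int \<Rightarrow> w22"
  where "w22_central m n =
    (if m + n = 0 then Poly_Mapping.single C (of_int (m ^ 3 - m) / 12) else 0)"

text \<open>The value at \<open>W m\<close>, \<open>L n\<close> is \<open>- [L n, W m]\<close>, the sign being absorbed by
  the antisymmetry of \<open>m - n\<close> and of \<open>w22_central\<close>.\<close>

fun w22_basis_bracket :: "w22_basis \<Rightarrow> w22_basis \<Rightarrow> w22"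
  where
    "w22_basis_bracket (L m) (L n) =
       Poly_Mapping.single (L (m + n)) (of_int (m - n)) + w22_central m n"
  | "w22_basis_bracket (L m) (W n) =
       Poly_Mapping.single (W (m + n)) (of_int (m - n)) + w22_central m n"
  | "w22_basis_bracket (W m) (L n) =
       Poly_Mapping.single (W (m + n)) (of_int (m - n)) + w22_central m n"
  | "w22_basis_bracket (W m) (W n) = 0"
  | "w22_basis_bracket C _ = 0"
  | "w22_basis_bracket _ C = 0"

definition w22_bracket :: "w22 \<Rightarrow> w22 \<Rightarrow> w22"
  where "w22_bracket = bilinear_ext w22_basis_bracket"


section \<open>Universal enveloping algebras\<close>

text \<open>The tensor algebra of the vector space \<open>'b \<Rightarrow>\<^sub>0 complex\<close> is the free associative
  unital algebra on its basis: it has the words in \<open>'b\<close> as a basis, and they multiply by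
  concatenation.\<close>

definition tensor_algebra :: "('b list \<Rightarrow>\<^sub>0 complex) ring"
  where "tensor_algebra =
    \<lparr>carrier = UNIV,
     mult = bilinear_ext (\<lambda>u v. Poly_Mapping.single (u @ v) 1),
     one = Poly_Mapping.single [] 1,
     zero = 0,
     add = (+)\<rparr>"

definition tensor_embed :: "('b \<Rightarrow>\<^sub>0 complex) \<Rightarrow> ('b list \<Rightarrow>\<^sub>0 complex)"
  where "tensor_embed x =
    (\<Sum>b\<in>Poly_Mapping.keys x. Poly_Mapping.single [b] (Poly_Mapping.lookup x b))"

definition enveloping_ideal ::
    "(('b \<Rightarrow>\<^sub>0 complex) \<Rightarrow> ('b \<Rightarrow>\<^sub>0 complex) \<Rightarrow> ('b \<Rightarrow>\<^sub>0 complex)) \<Rightarrow> ('b list \<Rightarrow>\<^sub>0 complex) set"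
  where "enveloping_ideal br =
    genideal tensor_algebra
      {tensor_embed x \<otimes>\<^bsub>tensor_algebra\<^esub> tensor_embed y
         - tensor_embed y \<otimes>\<^bsub>tensor_algebra\<^esub> tensor_embed x
         - tensor_embed (br x y) | x y. True}"

definition enveloping_algebra ::
    "(('b \<Rightarrow>\<^sub>0 complex) \<Rightarrow> ('b \<Rightarrow>\<^sub>0 complex) \<Rightarrow> ('b \<Rightarrow>\<^sub>0 complex)) \<Rightarrow> ('b list \<Rightarrow>\<^sub>0 complex) set ring"
  where "enveloping_algebra br = tensor_algebra Quot (enveloping_ideal br)"

type_synonym w22_env = "(w22_basis list \<Rightarrow>\<^sub>0 complex) set"

abbreviation U_w22 :: "w22_env ring"
  where "U_w22 \<equiv> enveloping_algebra w22_bracket"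

definition env_gen :: "w22_basis \<Rightarrow> w22_env"
  where "env_gen b =
    enveloping_ideal w22_bracket +>\<^bsub>tensor_algebra\<^esub> tensor_embed (Poly_Mapping.single b 1)"

definition env_scalar :: "complex \<Rightarrow> w22_env"
  where "env_scalar z =
    enveloping_ideal w22_bracket +>\<^bsub>tensor_algebra\<^esub> scale z \<one>\<^bsub>tensor_algebra\<^esub>"


section \<open>Left modules\<close>

text \<open>Left modules over a not necessarily commutative ring are represented by the \<open>module\<close>
  records of HOL-Algebra, whose fields \<open>mult\<close> and \<open>one\<close> play no role.  The locale
  \<open>Module.submodule\<close> does not require a commutative ring of scalars; its qualifier keeps it apart
  from the locale of the same name in \<open>VectorSpace\<close>, which does.\<close>

definition left_regular :: "('r, 'm) ring_scheme \<Rightarrow> ('r, 'r) module"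
  where "left_regular R =
    \<lparr>carrier = carrier R, mult = mult R, one = one R, zero = zero R, add = add R,
     smult = mult R\<rparr>"

definition left_ideal_gen :: "('r, 'm) ring_scheme \<Rightarrow> 'r set \<Rightarrow> 'r set"
  where "left_ideal_gen R X = (\<lambda>N. Module.submodule N R (left_regular R)) hull X"

text \<open>In the scalar multiplication of the quotient the union runs over equal cosets, as for
  \<open>rcoset_mult\<close> in the quotient rings of HOL-Algebra.\<close>

definition quotient_module :: "('r, 'a, 'm) module_scheme \<Rightarrow> 'a set \<Rightarrow> ('r, 'a set) module"
  where "quotient_module M N =
    \<lparr>carrier = a_rcosets\<^bsub>M\<^esub> N, mult = undefined, one = undefined, zero = N, add = set_add M,
     smult = (\<lambda>r X. \<Union>x\<in>X. N +>\<^bsub>M\<^esub> (r \<odot>\<^bsub>M\<^esub> x))\<rparr>"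

definition cyclic_submodule ::
    "('r, 'n) ring_scheme \<Rightarrow> ('r, 'a, 'm) module_scheme \<Rightarrow> 'a \<Rightarrow> 'a set"
  where "cyclic_submodule R M v = {u \<odot>\<^bsub>M\<^esub> v | u. u \<in> carrier R}"

definition maximal_proper_submodule ::
    "('r, 'n) ring_scheme \<Rightarrow> ('r, 'a, 'm) module_scheme \<Rightarrow> 'a set \<Rightarrow> bool"
  where "maximal_proper_submodule R M N \<longleftrightarrow>
    Module.submodule N R M \<and> N \<noteq> carrier M \<and>
    (\<forall>N'. Module.submodule N' R M \<and> N' \<noteq> carrier M \<and> N \<subseteq> N' \<longrightarrow> N' = N)"

definition complex_space :: "(w22_env, 'a, 'm) module_scheme \<Rightarrow> (complex, 'a) module"
  where "complex_space M =
    \<lparr>carrier = carrier M, mult = undefined, one = undefined, zero = zero M, add = add M,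
     smult = (\<lambda>z v. env_scalar z \<odot>\<^bsub>M\<^esub> v)\<rparr>"


section \<open>Verma modules and their irreducible quotients\<close>

definition verma_ideal :: "complex \<Rightarrow> complex \<Rightarrow> complex \<Rightarrow> w22_env set"
  where "verma_ideal c h1 h2 = left_ideal_gen U_w22
    ({env_gen (L m) | m. m > 0} \<union> {env_gen (W m) | m. m > 0} \<union>
     {env_gen C \<ominus>\<^bsub>U_w22\<^esub> env_scalar c,
      env_gen (L 0) \<ominus>\<^bsub>U_w22\<^esub> env_scalar h1,
      env_gen (W 0) \<ominus>\<^bsub>U_w22\<^esub> env_scalar h2})"

definition verma :: "complex \<Rightarrow> complex \<Rightarrow> complex \<Rightarrow> (w22_env, w22_env set) module"
  where "verma c h1 h2 = quotient_module (left_regular U_w22) (verma_ideal c h1 h2)"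

definition verma_hwv :: "complex \<Rightarrow> complex \<Rightarrow> complex \<Rightarrow> w22_env set"
  where "verma_hwv c h1 h2 = verma_ideal c h1 h2 +>\<^bsub>left_regular U_w22\<^esub> \<one>\<^bsub>U_w22\<^esub>"

definition verma_max :: "complex \<Rightarrow> complex \<Rightarrow> complex \<Rightarrow> w22_env set set"
  where "verma_max c h1 h2 = (THE J. maximal_proper_submodule U_w22 (verma c h1 h2) J)"

definition irred :: "complex \<Rightarrow> complex \<Rightarrow> complex \<Rightarrow> (w22_env, w22_env set set) module"
  where "irred c h1 h2 = quotient_module (verma c h1 h2) (verma_max c h1 h2)"

definition irred_hwv :: "complex \<Rightarrow> complex \<Rightarrow> complex \<Rightarrow> w22_env set set"
  where "irred_hwv c h1 h2 = verma_max c h1 h2 +>\<^bsub>verma c h1 h2\<^esub> verma_hwv c h1 h2"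

text \<open>\<open>gens_act M [b\<^sub>1, \<dots>, b\<^sub>k] v\<close> is \<open>b\<^sub>1 \<cdots> b\<^sub>k v\<close>.\<close>

definition gens_act :: "(w22_env, 'a, 'm) module_scheme \<Rightarrow> w22_basis list \<Rightarrow> 'a \<Rightarrow> 'a"
  where "gens_act M bs v = foldr (\<lambda>b w. env_gen b \<odot>\<^bsub>M\<^esub> w) bs v"

definition decreasing_gt1 :: "int list set"
  where "decreasing_gt1 = {ms. sorted_wrt (\<ge>) ms \<and> (\<forall>m\<in>set ms. m > 1)}"

definition irred_monomial :: "complex \<Rightarrow> complex \<Rightarrow> complex \<Rightarrow> int list \<Rightarrow> int list \<Rightarrow> w22_env set set"
  where "irred_monomial c h1 h2 ms ns =
    gens_act (irred c h1 h2)
      (map (\<lambda>m. W (- m)) ms @ map (\<lambda>n. L (- n)) ns) (irred_hwv c h1 h2)"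

end

theory Submission
  imports Defs "HOL-Library.Function_Algebras" "HOL-Library.List_Lexorder" "HOL-Library.Product_Lexorder"
begin

text \<open>
  Write \<open>J\<close> for the submodule generated by \<open>L\<^bsub>-1\<^esub>1\<close> and \<open>W\<^bsub>-1\<^esub>1\<close>. No Poincare-Birkhoff-Witt
  theorem is needed. Commuting letters to the right shows that the monomials in \<open>S\<close> span
  \<open>V(c,0,0)\<close> modulo \<open>J\<close>. That the quotient is nonzero follows from an explicit linear functional on
  the tensor algebra, the vacuum expectation value \<open>\<langle>x\<^sub>1 \<cdots> x\<^sub>k\<rangle>\<close>: it vanishes if \<open>x\<^sub>1\<close> has index at
  most 1, and otherwise it is the sum of the values of \<open>x\<^sub>2 \<cdots> x\<^sub>k\<close> with one letter \<open>x\<^sub>i\<close> replaced by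
  \<open>[x\<^sub>1, x\<^sub>i]\<close>. Left multiplication on the functionals obtained from it is a model of the quotient.

  Since \<open>c \<noteq> 0\<close>, the number \<open>c (n\<^sup>3 - n) / 12\<close> is nonzero for \<open>n > 1\<close>, so \<open>W\<^sub>n\<close> removes a factor
  \<open>L\<^bsub>-n\<^esub>\<close> and \<open>L\<^sub>n\<close> removes a factor \<open>W\<^bsub>-n\<^esub>\<close>. For a suitable ordering of \<open>S\<close> these operators
  send the largest monomial of a linear combination to a nonzero multiple of the vacuum and kill the
  others. Hence \<open>S\<close> is linearly independent, and every vector outside \<open>J\<close> is mapped to the vacuum
  modulo \<open>J\<close>; polynomials in \<open>L\<^sub>0\<close> remove the error term, so that every vector outside \<open>J\<close> generates
  \<open>V(c,0,0)\<close>, and \<open>J\<close> contains every proper submodule.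
\<close>

section \<open>Finitely supported functions\<close>

text \<open>The cut between indices 1 and 2 comes from the cocycle: \<open>m^3 - m\<close> vanishes
  exactly for m in {-1, 0, 1}. So the letters of index at most 1 and \<open>C\<close> span a
  subalgebra in which no bracket has a central part, the letters of index at least 2 span another
  one, and the vacuum can be killed by L_{-1} and W_{-1} besides the letters of nonnegative index.
  These two facts are what makes the recursion for the expectation value respect the commutation
  relations.

  Monomials are lowered by \<open>W\<close> operators before \<open>L\<close> operators, since the
  former commute with the block of \<open>W\<close> letters at the left. The error terms that a
  \<open>W\<close> operator leaves in the block of \<open>L\<close> letters are controlled only by
  the number of \<open>L\<close> factors, so the order on the monomials compares that number before
  anything else.

  Lowering works modulo J, which by itself only makes J a maximal submodule. That J contains every
  proper submodule requires reaching the vacuum in V(c,0,0) itself. The error lies in J and hence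
  has no component along the vacuum; its other components have nonzero weight and are killed by
  factors \<open>L 0 + d\<close>.\<close>

abbreviation "vs_linear \<equiv> Vector_Spaces.linear"

lemma lookup_scale [simp]: "Poly_Mapping.lookup (scale z p) b = z * Poly_Mapping.lookup p b"
  unfolding scale_def by transfer (simp add: when_def)

lemma scale_single [simp]: "scale z (Poly_Mapping.single b u) = Poly_Mapping.single b (z * u)"
  by (simp add: poly_mapping_eq_iff fun_eq_iff lookup_single when_def)

interpretation pm: vector_space scale
  by unfold_locales
    (simp_all add: poly_mapping_eq_iff fun_eq_iff lookup_add algebra_simps)

lemma vector_space_complex: "vector_space ((*) :: complex \<Rightarrow> complex \<Rightarrow> complex)"
  by unfold_locales (simp_all add: algebra_simps)

text \<open>The scaling is an argument because the targets vary: finitely supported functions,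
  complex numbers and functionals on words all occur.\<close>

definition lin_ext :: "(complex \<Rightarrow> 'v \<Rightarrow> 'v) \<Rightarrow> ('b \<Rightarrow> 'v) \<Rightarrow> ('b \<Rightarrow>\<^sub>0 complex) \<Rightarrow> 'v::ab_group_add"
  where "lin_ext s f x = (\<Sum>b\<in>Poly_Mapping.keys x. s (Poly_Mapping.lookup x b) (f b))"

lemma lin_ext_superset:
  fixes x :: "'c \<Rightarrow>\<^sub>0 complex" and s :: "complex \<Rightarrow> 'v \<Rightarrow> 'v::ab_group_add"
  assumes "vector_space s" "finite K" "Poly_Mapping.keys x \<subseteq> K"
  shows "lin_ext s f x = (\<Sum>b\<in>K. s (Poly_Mapping.lookup x b) (f b))"
proof -
  interpret vector_space s by fact
  show ?thesis unfolding lin_ext_def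
    using assms by (intro sum.mono_neutral_left) (auto simp: in_keys_iff)
qed

lemma linear_lin_ext:
  fixes s :: "complex \<Rightarrow> 'v \<Rightarrow> 'v::ab_group_add"
  assumes "vector_space s"
  shows "vs_linear scale s (lin_ext s f)"
proof -
  interpret vector_space s by fact
  show ?thesis
  proof (unfold_locales)
    fix x y :: "'a \<Rightarrow>\<^sub>0 complex"
    let ?K = "Poly_Mapping.keys x \<union> Poly_Mapping.keys y"
    have "Poly_Mapping.keys (x + y) \<subseteq> ?K" by (rule keys_add)
    then show "lin_ext s f (x + y) = lin_ext s f x + lin_ext s f y"
      using lin_ext_superset[OF assms, of ?K _ f] by (simp add: lookup_add scale_left_distrib sum.distrib)
  next
    fix z and x :: "'a \<Rightarrow>\<^sub>0 complex"
    have "Poly_Mapping.keys (scale z x) \<subseteq> Poly_Mapping.keys x" by (auto simp: in_keys_iff)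
    then show "lin_ext s f (scale z x) = s z (lin_ext s f x)"
      using lin_ext_superset[OF assms, of "Poly_Mapping.keys x" _ f] by (simp add: scale_sum_right)
  qed
qed

lemma lin_ext_single [simp]:
  fixes s :: "complex \<Rightarrow> 'v \<Rightarrow> 'v::ab_group_add"
  assumes "vector_space s"
  shows "lin_ext s f (Poly_Mapping.single b z) = s z (f b)"
proof -
  interpret vector_space s by fact
  show ?thesis unfolding lin_ext_def by (cases "z = 0") auto
qed

lemma poly_mapping_expand:
  "x = (\<Sum>b\<in>Poly_Mapping.keys x. scale (Poly_Mapping.lookup x b) (Poly_Mapping.single b 1))"
  by (auto simp: poly_mapping_eq_iff fun_eq_iff lookup_sum lookup_single when_def in_keys_iff
      if_distrib[of "(*) _"] cong: if_cong)

lemma linear_expand: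
  assumes "vs_linear scale s f"
  shows "f x = (\<Sum>b\<in>Poly_Mapping.keys x. s (Poly_Mapping.lookup x b) (f (Poly_Mapping.single b 1)))"
proof -
  interpret Vector_Spaces.linear scale s f by fact
  show ?thesis
    by (subst (1) poly_mapping_expand) (simp only: sum scale)
qed

lemma bilinear_ext_lin_ext:
  "bilinear_ext f x y = lin_ext scale (\<lambda>a. lin_ext scale (f a) y) x"
  unfolding bilinear_ext_def lin_ext_def by (simp add: pm.scale_sum_right)

lemma linear_bilinear_ext_left: "vs_linear scale scale (\<lambda>x. bilinear_ext f x y)"
  unfolding bilinear_ext_lin_ext by (rule linear_lin_ext[OF pm.vector_space_axioms])

lemma linear_bilinear_ext_right: "vs_linear scale scale (bilinear_ext f x)"
proof -
  have *: "vs_linear scale scale (lin_ext scale (f a))" for a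
    by (rule linear_lin_ext[OF pm.vector_space_axioms])
  show ?thesis
    unfolding bilinear_ext_lin_ext[abs_def] lin_ext_def[of _ _ x] module_hom_iff_linear[symmetric]
    by (intro module_pair.module_hom_sum module_pair.module_hom_scale)
      (use * in \<open>auto simp: module_hom_iff_linear module_pair_def pm.module_axioms\<close>)
qed

lemma bilinear_ext_single [simp]:
  "bilinear_ext f (Poly_Mapping.single a z) (Poly_Mapping.single b u) = scale (z * u) (f a b)"
  by (simp add: bilinear_ext_lin_ext lin_ext_single[OF pm.vector_space_axioms])

lemma bilinear_ext_add_left: "bilinear_ext f (x + y) z = bilinear_ext f x z + bilinear_ext f y z"
  and bilinear_ext_scale_left: "bilinear_ext f (scale r x) z = scale r (bilinear_ext f x z)"
  and bilinear_ext_zero_left [simp]: "bilinear_ext f 0 z = 0"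
  and bilinear_ext_diff_left: "bilinear_ext f (x - y) z = bilinear_ext f x z - bilinear_ext f y z"
  and bilinear_ext_sum_left: "bilinear_ext f (sum g S) z = (\<Sum>a\<in>S. bilinear_ext f (g a) z)"
proof -
  interpret Vector_Spaces.linear scale scale "\<lambda>x. bilinear_ext f x z" by (rule linear_bilinear_ext_left)
  show "bilinear_ext f (x + y) z = bilinear_ext f x z + bilinear_ext f y z"
    "bilinear_ext f (scale r x) z = scale r (bilinear_ext f x z)" "bilinear_ext f 0 z = 0"
    "bilinear_ext f (x - y) z = bilinear_ext f x z - bilinear_ext f y z"
    "bilinear_ext f (sum g S) z = (\<Sum>a\<in>S. bilinear_ext f (g a) z)"
    by (rule add, rule scale, rule zero, rule diff, rule sum)
qed

lemma bilinear_ext_add_right: "bilinear_ext f z (x + y) = bilinear_ext f z x + bilinear_ext f z y"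
  and bilinear_ext_scale_right: "bilinear_ext f z (scale r x) = scale r (bilinear_ext f z x)"
  and bilinear_ext_zero_right [simp]: "bilinear_ext f z 0 = 0"
  and bilinear_ext_diff_right: "bilinear_ext f z (x - y) = bilinear_ext f z x - bilinear_ext f z y"
  and bilinear_ext_sum_right: "bilinear_ext f z (sum g S) = (\<Sum>a\<in>S. bilinear_ext f z (g a))"
proof -
  interpret Vector_Spaces.linear scale scale "bilinear_ext f z" by (rule linear_bilinear_ext_right)
  show "bilinear_ext f z (x + y) = bilinear_ext f z x + bilinear_ext f z y"
    "bilinear_ext f z (scale r x) = scale r (bilinear_ext f z x)" "bilinear_ext f z 0 = 0"
    "bilinear_ext f z (x - y) = bilinear_ext f z x - bilinear_ext f z y"
    "bilinear_ext f z (sum g S) = (\<Sum>a\<in>S. bilinear_ext f z (g a))"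
    by (rule add, rule scale, rule zero, rule diff, rule sum)
qed

section \<open>Vacuum functionals\<close>

text \<open>The derivation of the tensor algebra that extends \<open>br z\<close> replaces one
  letter at a time; \<open>ad_sum br z f\<close> is \<open>f\<close> composed with it. Letters are
  arbitrary vectors here, so linearity in each letter has to be carried along separately.\<close>

fun ad_sum :: "('g \<Rightarrow> 'g \<Rightarrow> 'g) \<Rightarrow> 'g \<Rightarrow> ('g list \<Rightarrow> 'v::ab_group_add) \<Rightarrow> 'g list \<Rightarrow> 'v"
  where
    "ad_sum br z f [] = 0"
  | "ad_sum br z f (a # w) = f (br z a # w) + ad_sum br z (\<lambda>v. f (a # v)) w"

text \<open>As a congruence rule for function definitions it shows that \<open>f\<close> is
  evaluated only at words as long as \<open>w\<close>, which is what the termination of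
  \<open>vev\<close> rests on.\<close>

lemma ad_sum_cong [fundef_cong]:
  assumes "br = br'" "z = z'" "w = w'" "\<And>v. length v = length w' \<Longrightarrow> f v = g v"
  shows "ad_sum br z f w = ad_sum br' z' g w'"
  using assms(4) unfolding assms(1-3)
proof (induction w' arbitrary: f g)
  case (Cons a w)
  have "ad_sum br' z' (\<lambda>v. f (a # v)) w = ad_sum br' z' (\<lambda>v. g (a # v)) w"
    by (rule Cons.IH) (rule Cons.prems, simp)
  moreover have "f (br' z' a # w) = g (br' z' a # w)" by (rule Cons.prems) simp
  ultimately show ?case by simp
qed simp

lemma ad_sum_append:
  "ad_sum br z f (u @ w) = ad_sum br z (\<lambda>v. f (v @ w)) u + ad_sum br z (\<lambda>v. f (u @ v)) w"
  by (induction u arbitrary: f) (auto simp: add.assoc)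

lemma ad_sum_add: "ad_sum br z (\<lambda>v. f v + g v) w = ad_sum br z f w + ad_sum br z g w"
  by (induction w arbitrary: f g) (auto simp: algebra_simps)

lemma ad_sum_zero [simp]: "ad_sum br z (\<lambda>v. 0) w = 0"
  by (induction w) auto

lemma ad_sum_mult: "ad_sum br z (\<lambda>v. r * f v) w = r * ad_sum br z f w" for r :: complex
  by (induction w arbitrary: f) (auto simp: algebra_simps)

text \<open>Linearity in each letter is restricted to words of length \<open>n\<close>, because for
  \<open>vev\<close> it is proved by induction on the length.\<close>

definition multilinear :: "(complex \<Rightarrow> 'g \<Rightarrow> 'g) \<Rightarrow> nat \<Rightarrow> ('g::ab_group_add list \<Rightarrow> complex) \<Rightarrow> bool"
  where "multilinear sc n f \<longleftrightarrow>
    (\<forall>u x y w. length u + length w + 1 = n \<longrightarrow> f (u @ (x + y) # w) = f (u @ x # w) + f (u @ y # w)) \<and>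
    (\<forall>u r x w. length u + length w + 1 = n \<longrightarrow> f (u @ sc r x # w) = r * f (u @ x # w))"

lemma multilinear_add:
    "multilinear sc n f \<Longrightarrow> length u + length w + 1 = n \<Longrightarrow>
      f (u @ (x + y) # w) = f (u @ x # w) + f (u @ y # w)"
  and multilinear_scale:
    "multilinear sc n f \<Longrightarrow> length u + length w + 1 = n \<Longrightarrow> f (u @ sc r x # w) = r * f (u @ x # w)"
  unfolding multilinear_def by blast+

lemma multilinear_Cons: "multilinear sc (Suc n) f \<Longrightarrow> multilinear sc n (\<lambda>v. f (a # v))"
  using multilinear_add[of sc "Suc n" f "a # u" w for u w]
    multilinear_scale[of sc "Suc n" f "a # u" w for u w]
  unfolding multilinear_def[of sc n] by simp

text \<open>A letter in the range of the projection \<open>P\<close> is commuted to the right until it reaches the vacuum,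
  which it kills; the remaining part of a letter acts on the dual vacuum by the scalar \<open>\<kappa>\<close>. The last
  two assumptions are what makes this compatible with commutators.\<close>

locale lie_vacuum =
  fixes br :: "'g::ab_group_add \<Rightarrow> 'g \<Rightarrow> 'g" and sc :: "complex \<Rightarrow> 'g \<Rightarrow> 'g"
    and P :: "'g \<Rightarrow> 'g" and \<kappa> :: "'g \<Rightarrow> complex"
  assumes br_add_left: "br (x + y) z = br x z + br y z"
    and br_add_right: "br z (x + y) = br z x + br z y"
    and br_sc_left: "br (sc r x) z = sc r (br x z)"
    and br_sc_right: "br z (sc r x) = sc r (br z x)"
    and jacobi: "br (br x y) z + br y (br x z) = br x (br y z)"
    and P_add: "P (x + y) = P x + P y" and P_sc: "P (sc r x) = sc r (P x)"
    and \<kappa>_add: "\<kappa> (x + y) = \<kappa> x + \<kappa> y" and \<kappa>_sc: "\<kappa> (sc r x) = r * \<kappa> x"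
    and P_br: "P (br (P x) y) + br (P y) (P x) = P (br x y) + P (br (P y) x)"
    and \<kappa>_br: "\<kappa> (br (P x) y) = \<kappa> (br x y) + \<kappa> (br (P y) x)"
begin

function vev :: "'g list \<Rightarrow> complex"
  where
    "vev [] = 1"
  | "vev (x # w) = ad_sum br (P x) vev w + \<kappa> x * vev w"
  by pat_completeness auto
termination by (relation "measure length") auto

lemma ad_sum_add_left:
  "multilinear sc (length w) f \<Longrightarrow> ad_sum br (x + y) f w = ad_sum br x f w + ad_sum br y f w"
proof (induction w arbitrary: f)
  case (Cons a w)
  then show ?case
    using multilinear_add[of sc _ f "[]" w "br x a" "br y a"] multilinear_Cons[of sc "length w" f a]
    by (simp add: br_add_left algebra_simps)
qed auto

lemma ad_sum_sc_left:
  "multilinear sc (length w) f \<Longrightarrow> ad_sum br (sc r x) f w = r * ad_sum br x f w"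
proof (induction w arbitrary: f)
  case (Cons a w)
  then show ?case
    using multilinear_scale[of sc _ f "[]" w r "br x a"] multilinear_Cons[of sc "length w" f a]
    by (simp add: br_sc_left algebra_simps)
qed auto

lemma multilinear_ad_sum:
  assumes "multilinear sc n f" shows "multilinear sc n (ad_sum br z f)"
  unfolding multilinear_def
proof (intro conjI allI impI)
  fix u w :: "'g list" and x y assume n: "length u + length w + 1 = n"
  note * = multilinear_add[OF assms]
  have "ad_sum br z (\<lambda>v. f (v @ (x + y) # w)) u
      = ad_sum br z (\<lambda>v. f (v @ x # w) + f (v @ y # w)) u"
    using n by (intro ad_sum_cong) (auto intro!: *)
  moreover have "ad_sum br z (\<lambda>v. f (u @ (x + y) # v)) w
      = ad_sum br z (\<lambda>v. f (u @ x # v) + f (u @ y # v)) w"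
    using n by (intro ad_sum_cong) (auto intro!: *)
  ultimately show "ad_sum br z f (u @ (x + y) # w) = ad_sum br z f (u @ x # w) + ad_sum br z f (u @ y # w)"
    using n by (simp add: ad_sum_append ad_sum_add br_add_right *)
next
  fix u w :: "'g list" and r x assume n: "length u + length w + 1 = n"
  note * = multilinear_scale[OF assms]
  have "ad_sum br z (\<lambda>v. f (v @ sc r x # w)) u = ad_sum br z (\<lambda>v. r * f (v @ x # w)) u"
    using n by (intro ad_sum_cong) (auto intro!: *)
  moreover have "ad_sum br z (\<lambda>v. f (u @ sc r x # v)) w = ad_sum br z (\<lambda>v. r * f (u @ x # v)) w"
    using n by (intro ad_sum_cong) (auto intro!: *)
  ultimately show "ad_sum br z f (u @ sc r x # w) = r * ad_sum br z f (u @ x # w)"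
    using n by (simp add: ad_sum_append ad_sum_mult br_sc_right * algebra_simps)
qed

text \<open>By \<open>jacobi\<close> the derivations extending \<open>br x\<close> and
  \<open>br y\<close> have as commutator the one extending \<open>br x y\<close>. Composing
  functionals with them reverses the order of the two operators.\<close>

lemma ad_sum_commute:
  "multilinear sc (length w) f \<Longrightarrow>
    ad_sum br y (ad_sum br x f) w = ad_sum br x (ad_sum br y f) w + ad_sum br (br x y) f w"
proof (induction w arbitrary: f)
  case (Cons a w)
  have "f (br x (br y a) # w) = f (br (br x y) a # w) + f (br y (br x a) # w)"
    using multilinear_add[OF Cons.prems, of "[]" w] by (simp flip: jacobi[of x y a])
  moreover note Cons.IH[OF multilinear_Cons, of f a] Cons.prems
  ultimately show ?case by (simp add: ad_sum_add algebra_simps)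
qed auto

lemma multilinear_vev: "multilinear sc n vev"
proof (induction n)
  case 0
  show ?case unfolding multilinear_def by auto
next
  case (Suc n)
  note IH = Suc.IH and IH' = multilinear_ad_sum[OF Suc.IH]
  show ?case unfolding multilinear_def
  proof (intro conjI allI impI)
    fix u w :: "'g list" and x y assume n: "length u + length w + 1 = Suc n"
    show "vev (u @ (x + y) # w) = vev (u @ x # w) + vev (u @ y # w)"
    proof (cases u)
      case Nil
      then have "ad_sum br (P (x + y)) vev w = ad_sum br (P x) vev w + ad_sum br (P y) vev w"
        using n IH by (simp add: P_add ad_sum_add_left)
      then show ?thesis by (simp add: Nil \<kappa>_add algebra_simps)
    next
      case (Cons a v)
      have "length v + length w + 1 = n" using n Cons by simp
      note * = multilinear_add[OF IH this] multilinear_add[OF IH' this]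
      show ?thesis by (simp add: Cons * distrib_left)
    qed
  next
    fix u w :: "'g list" and r x assume n: "length u + length w + 1 = Suc n"
    show "vev (u @ sc r x # w) = r * vev (u @ x # w)"
    proof (cases u)
      case Nil
      then have "ad_sum br (P (sc r x)) vev w = r * ad_sum br (P x) vev w"
        using n IH by (simp add: P_sc ad_sum_sc_left)
      then show ?thesis by (simp add: Nil \<kappa>_sc algebra_simps)
    next
      case (Cons a v)
      have "length v + length w + 1 = n" using n Cons by simp
      note * = multilinear_scale[OF IH this] multilinear_scale[OF IH' this]
      show ?thesis by (simp add: Cons * algebra_simps)
    qed
  qed
qed

lemmas vev_add = multilinear_add[OF multilinear_vev refl]
  and vev_scale = multilinear_scale[OF multilinear_vev refl]

lemma vev_zero: "vev (u @ 0 # w) = 0"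
  using vev_add[of u 0 0 w] by simp

text \<open>After both letters are expanded, the terms in which each of them acts on
  \<open>w\<close> differ by the action of \<open>br (P x) (P y)\<close>. The terms that remain
  agree by \<open>P_br\<close> for the part acting on \<open>w\<close> and by
  \<open>\<kappa>_br\<close> for the scalar part.\<close>

lemma vev_commutator_Nil: "vev (x # y # w) = vev (y # x # w) + vev (br x y # w)"
proof -
  note add = ad_sum_add_left[OF multilinear_vev]
  have "ad_sum br (P (br (P x) y)) vev w + ad_sum br (br (P y) (P x)) vev w
      = ad_sum br (P (br x y)) vev w + ad_sum br (P (br (P y) x)) vev w"
    by (simp add: P_br flip: add)
  moreover have "ad_sum br (P x) (\<lambda>v. vev (y # v)) w
      = ad_sum br (P x) (ad_sum br (P y) vev) w + \<kappa> y * ad_sum br (P x) vev w"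
    "ad_sum br (P y) (\<lambda>v. vev (x # v)) w
      = ad_sum br (P y) (ad_sum br (P x) vev) w + \<kappa> x * ad_sum br (P y) vev w"
    by (simp_all add: ad_sum_add ad_sum_mult)
  moreover note ad_sum_commute[OF multilinear_vev, of "P x" "P y" w] \<kappa>_br[of x y]
  ultimately show ?thesis
    by (simp add: ad_sum_commute[OF multilinear_vev, of "P x" "P y" w] algebra_simps)
qed

lemma vev_commutator: "vev (u @ x # y # w) = vev (u @ y # x # w) + vev (u @ br x y # w)"
proof (induction "length u + length w" arbitrary: u x y w rule: less_induct)
  case less
  show ?case
  proof (cases u)
    case Nil
    then show ?thesis using vev_commutator_Nil[of x y w] by (simp only: append_Nil)
  next
    case (Cons a u')
    let ?z = "P a"
    have 1: "ad_sum br ?z (\<lambda>v. vev (v @ x # y # w)) u'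
        = ad_sum br ?z (\<lambda>v. vev (v @ y # x # w) + vev (v @ br x y # w)) u'"
      by (intro ad_sum_cong refl less) (simp add: Cons)
    have 2: "ad_sum br ?z (\<lambda>v. vev (u' @ x # y # v)) w
        = ad_sum br ?z (\<lambda>v. vev (u' @ y # x # v) + vev (u' @ br x y # v)) w"
      by (intro ad_sum_cong refl less) (simp add: Cons)
    have IH: "vev (u' @ p # q # w) = vev (u' @ q # p # w) + vev (u' @ br p q # w)" for p q
      by (rule less) (simp add: Cons)
    have "vev (u' @ br ?z (br x y) # w) = vev (u' @ br (br ?z x) y # w) + vev (u' @ br x (br ?z y) # w)"
      by (simp flip: jacobi[of ?z x y] vev_add)
    then show ?thesis
      by (simp add: Cons ad_sum_append 1 2 ad_sum_add IH[of x y] IH[of "br ?z x" y] IH[of x "br ?z y"] algebra_simps)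
  qed
qed

text \<open>\<open>A\<close> is a space of letters that kill the vacuum. Commuting other letters to
  the right changes the last letter only within \<open>A\<close>; once it stands alone, its value is
  \<open>\<kappa> x\<close>.\<close>

lemma vev_annihilate:
  assumes "\<And>x. x \<in> A \<Longrightarrow> \<kappa> x = 0" "\<And>x y. x \<in> A \<Longrightarrow> br (P y) x \<in> A" "x \<in> A"
  shows "vev (w @ [x]) = 0"
  using assms(3)
proof (induction "length w" arbitrary: w x rule: less_induct)
  case less
  show ?case
  proof (cases w)
    case Nil
    then show ?thesis using assms(1) less.prems by simp
  next
    case (Cons a u)
    have "ad_sum br (P a) (\<lambda>v. vev (v @ [x])) u = ad_sum br (P a) (\<lambda>v. 0) u"
      by (intro ad_sum_cong refl less) (simp_all add: Cons less.prems)
    then show ?thesis using less assms(2) by (simp add: Cons ad_sum_append)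
  qed
qed

lemma vev_central:
  assumes "P z = 0" "\<And>x. br x z = 0" "\<And>x. br 0 x = 0"
  shows "vev (u @ z # w) = \<kappa> z * vev (u @ w)"
proof (induction "length u + length w" arbitrary: u w rule: less_induct)
  case less
  show ?case
  proof (cases u)
    case Nil
    have "ad_sum br 0 vev w = ad_sum br 0 (\<lambda>v. 0) w"
      using ad_sum_add_left[OF multilinear_vev, of 0 0 w] by simp
    then show ?thesis using assms Nil by simp
  next
    case (Cons a u')
    have 1: "ad_sum br (P a) (\<lambda>v. vev (v @ z # w)) u' = ad_sum br (P a) (\<lambda>v. \<kappa> z * vev (v @ w)) u'"
      by (intro ad_sum_cong refl less) (simp add: Cons)
    have 2: "ad_sum br (P a) (\<lambda>v. vev (u' @ z # v)) w = ad_sum br (P a) (\<lambda>v. \<kappa> z * vev (u' @ v)) w"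
      by (intro ad_sum_cong refl less) (simp add: Cons)
    have "vev (u' @ z # w) = \<kappa> z * vev (u' @ w)"
      by (rule less) (simp add: Cons)
    then show ?thesis
      by (simp add: Cons ad_sum_append 1 2 ad_sum_mult assms vev_zero algebra_simps)
  qed
qed

end

section \<open>The vacuum functional of W(2,2)\<close>

text \<open>The case of zero is contained in \<open>scale\<close>, with factor 0. The rule reduces
  multilinear identities to basis vectors, one argument at a time.\<close>

lemma poly_mapping_linear_induct [case_names single add scale]:
  assumes "\<And>b. Q (Poly_Mapping.single b 1)"
    and "\<And>x y. Q x \<Longrightarrow> Q y \<Longrightarrow> Q (x + y)" and "\<And>r x. Q x \<Longrightarrow> Q (scale r x)"
  shows "Q (x :: 'b \<Rightarrow>\<^sub>0 complex)"
proof -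
  have Q0: "Q 0"
    using assms(3)[OF assms(1)[of undefined], of 0] by simp
  have "Q (\<Sum>b\<in>B. scale (Poly_Mapping.lookup x b) (Poly_Mapping.single b 1))" if "finite B" for B
    using that by (induction B) (simp_all add: Q0 assms del: scale_single)
  then show ?thesis
    by (subst poly_mapping_expand) simp
qed

lemma w22_bracket_single [simp]:
  "w22_bracket (Poly_Mapping.single a u) (Poly_Mapping.single b v) = scale (u * v) (w22_basis_bracket a b)"
  by (simp add: w22_bracket_def)

lemmas w22_bracket_bilinear =
  bilinear_ext_add_left[of w22_basis_bracket, folded w22_bracket_def]
  bilinear_ext_add_right[of w22_basis_bracket, folded w22_bracket_def]
  bilinear_ext_scale_left[of w22_basis_bracket, folded w22_bracket_def]
  bilinear_ext_scale_right[of w22_basis_bracket, folded w22_bracket_def]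
lemmas w22_bracket_zero [simp] =
  bilinear_ext_zero_left[of w22_basis_bracket, folded w22_bracket_def]
  bilinear_ext_zero_right[of w22_basis_bracket, folded w22_bracket_def]

lemma w22_basis_bracket_C [simp]: "w22_basis_bracket b C = 0"
  by (cases b) auto

lemma w22_bracket_central [simp]:
  "w22_bracket (w22_central m n) x = 0" "w22_bracket x (w22_central m n) = 0"
  by (induction x rule: poly_mapping_linear_induct)
    (auto simp: w22_central_def w22_bracket_bilinear)

lemma solve_third: "x + (y + z) = 0 \<Longrightarrow> z = - x - y" for x y z :: int
  by simp

lemma neg_of_sum_zero: "x + y = 0 \<Longrightarrow> y = - x" for x y :: int
  by simp

lemma both_eq_one: "\<not> 2 \<le> x \<Longrightarrow> \<not> 2 \<le> y \<Longrightarrow> 2 \<le> x + y \<Longrightarrow> x = 1 \<and> y = 1" for x y :: int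
  by simp

lemma small_index: "\<not> 2 \<le> x \<Longrightarrow> \<not> 2 \<le> - x \<Longrightarrow> x = -1 \<or> x = 0 \<or> x = 1" for x :: int
  by presburger

lemma sum_eqs:
  fixes a b :: "'b \<Rightarrow>\<^sub>0 complex"
  shows "a + b = e \<Longrightarrow> a' + b' = e' \<Longrightarrow> a + a' + (b + b') = e + e'"
    and "a + b = e \<Longrightarrow> scale r a + scale r b = scale r e"
    and "a + b = e + f \<Longrightarrow> a' + b' = e' + f' \<Longrightarrow> a + a' + (b + b') = e + e' + (f + f')"
    and "a + b = e + f \<Longrightarrow> scale r a + scale r b = scale r e + scale r f"
proof -
  have add: "u + u' + (v + v') = (u + v) + (u' + v')" for u u' v v' :: "'b \<Rightarrow>\<^sub>0 complex"
    by (simp add: add_ac)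
  show "a + b = e \<Longrightarrow> a' + b' = e' \<Longrightarrow> a + a' + (b + b') = e + e'"
    by (subst add) simp
  show "a + b = e + f \<Longrightarrow> a' + b' = e' + f' \<Longrightarrow> a + a' + (b + b') = e + e' + (f + f')"
    by (subst add, subst add[of e]) simp
qed (simp_all flip: pm.scale_right_distrib)

lemma w22_jacobi_basis:
  fixes a b d
  defines "x \<equiv> Poly_Mapping.single a 1" and "y \<equiv> Poly_Mapping.single b 1" and "z \<equiv> Poly_Mapping.single d 1"
  shows "w22_bracket (w22_bracket x y) z + w22_bracket y (w22_bracket x z) = w22_bracket x (w22_bracket y z)"
  unfolding x_def y_def z_def
  apply (cases a; cases b; cases d)
  apply (simp_all add: w22_bracket_bilinear)
  apply (auto simp: w22_central_def algebra_simps simp flip: single_add)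
  \<comment> \<open>Double brackets have a central part only if the three indices add up to 0. With
    the third index eliminated, a polynomial identity in the other two is left.\<close>
  apply (drule solve_third; hypsubst; rule poly_mapping_eqI;
      simp add: lookup_add lookup_single when_def field_simps power3_eq_cube; fail)+
  done

lemma w22_jacobi:
  "w22_bracket (w22_bracket x y) z + w22_bracket y (w22_bracket x z) = w22_bracket x (w22_bracket y z)"
proof (induction x rule: poly_mapping_linear_induct)
  case (single a)
  show ?case
  proof (induction y rule: poly_mapping_linear_induct)
    case (single b)
    show ?case
    proof (induction z rule: poly_mapping_linear_induct)
      case (single d)
      show ?case by (rule w22_jacobi_basis)
    next
      case (add z z')
      then show ?case unfolding w22_bracket_bilinear by (rule sum_eqs)
    next
      case (scale r z)
      then show ?case unfolding w22_bracket_bilinear by (rule sum_eqs)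
    qed
  next
    case (add y y')
    then show ?case unfolding w22_bracket_bilinear by (rule sum_eqs)
  next
    case (scale r y)
    then show ?case unfolding w22_bracket_bilinear by (rule sum_eqs)
  qed
next
  case (add x x')
  then show ?case unfolding w22_bracket_bilinear by (rule sum_eqs)
next
  case (scale r x)
  then show ?case unfolding w22_bracket_bilinear by (rule sum_eqs)
qed

section \<open>The splitting of W(2,2) between indices 1 and 2\<close>

fun basis_index :: "w22_basis \<Rightarrow> int"
  where "basis_index (L m) = m" | "basis_index (W m) = m" | "basis_index C = 0"

definition high_part :: "w22 \<Rightarrow> w22"
  where "high_part = lin_ext scale (\<lambda>b. if basis_index b \<ge> 2 then Poly_Mapping.single b 1 else 0)"

lemma high_part_simps [simp]:
  "high_part (x + y) = high_part x + high_part y" "high_part (scale r x) = scale r (high_part x)"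
  "high_part 0 = 0"
  "high_part (Poly_Mapping.single b r) = (if basis_index b \<ge> 2 then Poly_Mapping.single b r else 0)"
proof -
  interpret Vector_Spaces.linear scale scale high_part
    unfolding high_part_def by (rule linear_lin_ext[OF pm.vector_space_axioms])
  show "high_part (x + y) = high_part x + high_part y" "high_part (scale r x) = scale r (high_part x)"
  "high_part 0 = 0" by (rule add, rule scale, rule zero)
  show "high_part (Poly_Mapping.single b r) = (if basis_index b \<ge> 2 then Poly_Mapping.single b r else 0)"
    by (simp add: high_part_def lin_ext_single[OF pm.vector_space_axioms])
qed

text \<open>With x = x' + x'' split into high and low part, and y likewise, antisymmetry reduces the
  identity to two statements: [x', y'] is its own high part, and [x'', y''] has none. In other
  words, both summands are subalgebras.\<close>

lemma high_part_bracket: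
  "high_part (w22_bracket (high_part x) y) + w22_bracket (high_part y) (high_part x)
    = high_part (w22_bracket x y) + high_part (w22_bracket (high_part y) x)"
proof (induction x rule: poly_mapping_linear_induct)
  case (single a)
  show ?case
  proof (induction y rule: poly_mapping_linear_induct)
    case (single b)
    show ?case
      apply (cases a; cases b)
      apply (auto simp: w22_bracket_bilinear w22_central_def algebra_simps simp flip: single_add single_uminus)
      \<comment> \<open>Two indices of at most 1 can only reach the sum 2 as 1 + 1, and there the
        coefficient \<open>m - n\<close> is 0.\<close>
      apply (drule (2) both_eq_one; simp)+
      done
  next
    case (add y y')
    then show ?case unfolding w22_bracket_bilinear high_part_simps(1,2) by (rule sum_eqs)
  next
    case (scale r y)
    then show ?case unfolding w22_bracket_bilinear high_part_simps(1,2) by (rule sum_eqs)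
  qed
next
  case (add x x')
  then show ?case unfolding w22_bracket_bilinear high_part_simps(1,2) by (rule sum_eqs)
next
  case (scale r x)
  then show ?case unfolding w22_bracket_bilinear high_part_simps(1,2) by (rule sum_eqs)
qed

lemma complex_sum_eqs:
  fixes a b :: complex
  shows "a = b + e \<Longrightarrow> a' = b' + e' \<Longrightarrow> a + a' = b + b' + (e + e')"
    and "a = b + e \<Longrightarrow> r * a = r * b + r * e"
  by (simp_all add: algebra_simps)

text \<open>A central term needs opposite indices. Two high letters never have these, and two low
  ones only within -1, 0, 1, where \<open>m^3 - m\<close> is 0. The mixed brackets cancel by
  antisymmetry.\<close>

lemma central_part_bracket:
  "Poly_Mapping.lookup (w22_bracket (high_part x) y) C
    = Poly_Mapping.lookup (w22_bracket x y) C + Poly_Mapping.lookup (w22_bracket (high_part y) x) C"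
proof (induction x rule: poly_mapping_linear_induct)
  case (single a)
  show ?case
  proof (induction y rule: poly_mapping_linear_induct)
    case (single b)
    show ?case
      apply (cases a; cases b)
      apply (auto simp: w22_central_def lookup_add lookup_single simp del: of_int_diff)
      apply (drule neg_of_sum_zero; hypsubst; (drule (1) small_index; elim disjE)?;
          simp add: field_simps power3_eq_cube; fail)+
      done
  next
    case (add y y')
    then show ?case unfolding w22_bracket_bilinear high_part_simps(1,2) lookup_add by (rule complex_sum_eqs)
  next
    case (scale r y)
    then show ?case unfolding w22_bracket_bilinear high_part_simps(1,2) lookup_scale by (rule complex_sum_eqs)
  qed
next
  case (add x x')
  then show ?case unfolding w22_bracket_bilinear high_part_simps(1,2) lookup_add by (rule complex_sum_eqs)
next
  case (scale r x)
  then show ?case unfolding w22_bracket_bilinear high_part_simps(1,2) lookup_scale by (rule complex_sum_eqs)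
qed

lemma w22_lie_vacuum: "lie_vacuum w22_bracket scale high_part (\<lambda>x. c * Poly_Mapping.lookup x C)"
  apply unfold_locales
              apply (simp add: w22_bracket_bilinear)
             apply (simp add: w22_bracket_bilinear)
            apply (simp add: w22_bracket_bilinear)
           apply (simp add: w22_bracket_bilinear)
          apply (rule w22_jacobi)
         apply simp
        apply simp
       apply (simp add: lookup_add distrib_left)
      apply simp
     apply (rule high_part_bracket)
    apply (subst central_part_bracket, simp only: distrib_left)
  done


section \<open>The vacuum functional on words in the basis letters\<close>

type_synonym functional = "w22_basis list \<Rightarrow> complex"

definition vac :: "complex \<Rightarrow> functional"
  where "vac c w = lie_vacuum.vev w22_bracket high_part (\<lambda>x. c * Poly_Mapping.lookup x C)
    (map (\<lambda>b. Poly_Mapping.single b 1) w)"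

lemmas w22_vev = lie_vacuum.vev.simps(1)[OF w22_lie_vacuum] lie_vacuum.vev_add[OF w22_lie_vacuum]
  lie_vacuum.vev_scale[OF w22_lie_vacuum]

lemma vac_Nil [simp]: "vac c [] = 1"
  by (simp add: vac_def w22_vev)

lemma linear_vev: "vs_linear scale (*)
    (\<lambda>x. lie_vacuum.vev w22_bracket high_part (\<lambda>x. c * Poly_Mapping.lookup x C) (u @ x # w))"
  unfolding module_hom_iff_linear[symmetric] module_hom_iff
  using vector_space_complex pm.module_axioms
  by (simp add: w22_vev module_iff_vector_space)

lemma vac_commutator:
  "vac c (u @ a # b # w) = vac c (u @ b # a # w) + lin_ext (*) (\<lambda>d. vac c (u @ d # w)) (w22_basis_bracket a b)"
  using lie_vacuum.vev_commutator[OF w22_lie_vacuum, of c "map (\<lambda>b. Poly_Mapping.single b 1) u"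
      "Poly_Mapping.single a 1" "Poly_Mapping.single b 1" "map (\<lambda>b. Poly_Mapping.single b 1) w"]
  by (simp add: vac_def lin_ext_def linear_expand[OF linear_vev, of _ _ "w22_basis_bracket a b"])

lemma vac_central: "vac c (u @ C # w) = c * vac c (u @ w)"
proof -
  have "w22_bracket x (Poly_Mapping.single C 1) = 0" for x
    by (induction x rule: poly_mapping_linear_induct) (simp_all add: w22_bracket_bilinear)
  then show ?thesis
    unfolding vac_def using lie_vacuum.vev_central[OF w22_lie_vacuum, of "Poly_Mapping.single C 1"] by simp
qed

text \<open>The two indices add up to at least 1, so no central term arises. This makes the letters
  other than \<open>C\<close> of index at least -1 a space to which \<open>vev_annihilate\<close>
  applies.\<close>

lemma w22_basis_bracket_non_central:
  assumes "2 \<le> basis_index a" "-1 \<le> basis_index b" "b \<noteq> C"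
  shows "w22_basis_bracket a b \<in> pm.span {Poly_Mapping.single d 1 |d. d \<noteq> C \<and> -1 \<le> basis_index d}"
proof -
  have "Poly_Mapping.single d r \<in> pm.span {Poly_Mapping.single d 1 |d. d \<noteq> C \<and> -1 \<le> basis_index d}"
    if "d \<noteq> C" "-1 \<le> basis_index d" for d r
  proof -
    have "scale r (Poly_Mapping.single d 1) \<in> pm.span {Poly_Mapping.single d 1 |d. d \<noteq> C \<and> -1 \<le> basis_index d}"
      using that by (intro pm.span_scale pm.span_base) auto
    then show ?thesis by simp
  qed
  then show ?thesis
    using assms by (cases a; cases b) (auto simp: w22_central_def pm.span_zero)
qed

lemma vac_annihilate:
  assumes "b \<noteq> C" "-1 \<le> basis_index b"
  shows "vac c (w @ [b]) = 0"
proof -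
  let ?B = "{Poly_Mapping.single d 1 |d. d \<noteq> C \<and> -1 \<le> basis_index d} :: w22 set"
  have 1: "c * Poly_Mapping.lookup x C = 0" if "x \<in> pm.span ?B" for x
    using that
  proof (induction rule: pm.span_induct_alt)
    case (step r x y)
    then have "Poly_Mapping.lookup x C = 0" by (auto simp: lookup_single)
    then show ?case using step by (simp add: lookup_add)
  qed simp
  have single: "w22_bracket (high_part y) (Poly_Mapping.single b 1) \<in> pm.span ?B"
    if "b \<noteq> C" "-1 \<le> basis_index b" for y b
    using that
  proof (induction y rule: poly_mapping_linear_induct)
    case (single a)
    then show ?case using w22_basis_bracket_non_central[of a b] by (auto simp: pm.span_zero)
  qed (auto simp: w22_bracket_bilinear intro: pm.span_add pm.span_scale)
  have 2: "w22_bracket (high_part y) x \<in> pm.span ?B" if "x \<in> pm.span ?B" for x y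
    using that
  proof (induction rule: pm.span_induct_alt)
    case (step r x z)
    then show ?case
      by (auto simp: w22_bracket_bilinear intro!: pm.span_add pm.span_scale single)
  qed (simp add: pm.span_zero)
  have 3: "Poly_Mapping.single b 1 \<in> pm.span ?B"
    using assms by (intro pm.span_base) auto
  show ?thesis
    unfolding vac_def
    using lie_vacuum.vev_annihilate[OF w22_lie_vacuum, of "pm.span ?B" c, OF 1 2 3] by simp
qed

section \<open>Functionals on words as a left module\<close>

definition fscale :: "complex \<Rightarrow> functional \<Rightarrow> functional"
  where "fscale r f = (\<lambda>w. r * f w)"

lemma fscale_apply: "fscale r f w = r * f w"
  by (simp add: fscale_def)

interpretation fs: vector_space fscale
  by unfold_locales (simp_all add: fun_eq_iff fscale_apply algebra_simps)

text \<open>Right translation in the argument is a left action on functionals: applying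
  \<open>b\<close> and then \<open>a\<close> evaluates \<open>f\<close> at
  \<open>w @ [a, b]\<close>. The vector \<open>x\<close> applied to the vacuum is thereby
  represented by its matrix coefficients, sending \<open>w\<close> to the expectation value of
  \<open>w x\<close>.\<close>

definition act :: "w22_basis \<Rightarrow> functional \<Rightarrow> functional"
  where "act b f = (\<lambda>w. f (w @ [b]))"

lemma act_linear [simp]:
  "act b (f + g) = act b f + act b g" "act b (f - g) = act b f - act b g"
  "act b (fscale r f) = fscale r (act b f)" "act b 0 = 0"
  unfolding act_def fscale_def plus_fun_def fun_diff_def zero_fun_def by (rule refl)+

text \<open>Extended linearly to the tensor algebra, these are the functionals vanishing on the
  two-sided ideal generated by the commutation relations and \<open>C - c\<close>: the dual space of
  the enveloping algebra at central charge \<open>c\<close>.\<close>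

definition w22_dual :: "complex \<Rightarrow> functional set"
  where "w22_dual c = {f.
    (\<forall>u a b w. f (u @ a # b # w) = f (u @ b # a # w) + lin_ext (*) (\<lambda>d. f (u @ d # w)) (w22_basis_bracket a b)) \<and>
    (\<forall>u w. f (u @ C # w) = c * f (u @ w))}"

lemma vac_in_dual [simp]: "vac c \<in> w22_dual c"
  unfolding w22_dual_def using vac_commutator vac_central by blast

lemma w22_dualD:
  assumes "f \<in> w22_dual c"
  shows "f (u @ a # b # w) = f (u @ b # a # w) + lin_ext (*) (\<lambda>d. f (u @ d # w)) (w22_basis_bracket a b)"
    and "f (u @ C # w) = c * f (u @ w)"
  using assms unfolding w22_dual_def by blast+

lemma w22_dualI:
  assumes "\<And>u a b w. f (u @ a # b # w)
      = f (u @ b # a # w) + lin_ext (*) (\<lambda>d. f (u @ d # w)) (w22_basis_bracket a b)"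
    and "\<And>u w. f (u @ C # w) = c * f (u @ w)"
  shows "f \<in> w22_dual c"
  using assms unfolding w22_dual_def by blast

lemma lin_ext_complex_linear:
  "lin_ext (*) (\<lambda>d. f d + g d) x = lin_ext (*) f x + lin_ext (*) g x"
  "lin_ext (*) (\<lambda>d. r * f d) x = r * lin_ext (*) f x" for r :: complex
  by (simp_all add: lin_ext_def sum.distrib sum_distrib_left algebra_simps)

lemma subspace_dual: "fs.subspace (w22_dual c)"
proof (rule fs.subspaceI)
  show "0 \<in> w22_dual c" by (rule w22_dualI) (simp_all add: lin_ext_def)
next
  fix f g assume f: "f \<in> w22_dual c" and g: "g \<in> w22_dual c"
  show "f + g \<in> w22_dual c"
  proof (rule w22_dualI)
    fix u a b w
    show "(f + g) (u @ a # b # w)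
        = (f + g) (u @ b # a # w) + lin_ext (*) (\<lambda>d. (f + g) (u @ d # w)) (w22_basis_bracket a b)"
      using w22_dualD(1)[OF f, of u a b w] w22_dualD(1)[OF g, of u a b w]
      by (simp add: lin_ext_complex_linear)
  next
    fix u w
    show "(f + g) (u @ C # w) = c * (f + g) (u @ w)"
      using w22_dualD(2)[OF f, of u w] w22_dualD(2)[OF g, of u w] by (simp add: distrib_left)
  qed
next
  fix r f assume f: "f \<in> w22_dual c"
  show "fscale r f \<in> w22_dual c"
  proof (rule w22_dualI)
    fix u a b w
    show "fscale r f (u @ a # b # w)
        = fscale r f (u @ b # a # w) + lin_ext (*) (\<lambda>d. fscale r f (u @ d # w)) (w22_basis_bracket a b)"
      using w22_dualD(1)[OF f, of u a b w] by (simp add: lin_ext_complex_linear distrib_left fscale_apply)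
  next
    fix u w
    show "fscale r f (u @ C # w) = c * fscale r f (u @ w)"
      using w22_dualD(2)[OF f, of u w] by (simp add: fscale_apply)
  qed
qed

lemmas dual_closed [simp, intro] = fs.subspace_0[OF subspace_dual] fs.subspace_add[OF subspace_dual]
  fs.subspace_scale[OF subspace_dual] fs.subspace_diff[OF subspace_dual]

lemma act_in_dual [simp, intro]:
  assumes "f \<in> w22_dual c" shows "act b f \<in> w22_dual c"
proof (rule w22_dualI)
  fix u x y w
  show "act b f (u @ x # y # w)
      = act b f (u @ y # x # w) + lin_ext (*) (\<lambda>d. act b f (u @ d # w)) (w22_basis_bracket x y)"
    using w22_dualD(1)[OF assms, of u x y "w @ [b]"] by (simp add: act_def)
next
  fix u w
  show "act b f (u @ C # w) = c * act b f (u @ w)"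
    using w22_dualD(2)[OF assms, of u "w @ [b]"] by (simp add: act_def)
qed

definition cocycle :: "complex \<Rightarrow> int \<Rightarrow> complex"
  where "cocycle c n = c * (of_int (n ^ 3 - n) / 12)"

lemma dual_act_commutator:
  "f \<in> w22_dual c \<Longrightarrow> act a (act b f) w = act b (act a f) w + lin_ext (*) (\<lambda>d. act d f w) (w22_basis_bracket a b)"
  using w22_dualD(1)[of f c w a b "[]"] by (simp add: act_def)

lemma dual_act_C:
  assumes "f \<in> w22_dual c" shows "act C f w = c * f w"
proof -
  have "f (w @ C # []) = c * f (w @ [])" using assms unfolding w22_dual_def by blast
  then show ?thesis by (simp add: act_def)
qed

lemmas lin_ext_complex_simps =
  module_hom.add[OF module_hom_linearI, OF linear_lin_ext[OF vector_space_complex]]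
  module_hom.zero[OF module_hom_linearI, OF linear_lin_ext[OF vector_space_complex]]
  lin_ext_single[OF vector_space_complex]

lemma act_commute:
  assumes "f \<in> w22_dual c"
  shows act_W_W: "act (W m) (act (W n) f) = act (W n) (act (W m) f)"
    and act_L_W: "act (L m) (act (W n) f) = act (W n) (act (L m) f)
      + fscale (of_int (m - n)) (act (W (m + n)) f) + fscale (if m + n = 0 then cocycle c m else 0) f"
    and act_W_L: "act (W m) (act (L n) f) = act (L n) (act (W m) f)
      + fscale (of_int (m - n)) (act (W (m + n)) f) + fscale (if m + n = 0 then cocycle c m else 0) f"
  using dual_act_commutator[OF assms, of "W m" "W n"] dual_act_commutator[OF assms, of "L m" "W n"]
    dual_act_commutator[OF assms, of "W m" "L n"]
  by (auto simp: fun_eq_iff fscale_apply lin_ext_complex_simps w22_central_def cocycle_def dual_act_C[OF assms])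

lemma act_vac [simp]: "-1 \<le> m \<Longrightarrow> act (L m) (vac c) = 0" "-1 \<le> m \<Longrightarrow> act (W m) (vac c) = 0"
  by (auto simp: fun_eq_iff act_def vac_annihilate)

declare plus_fun_apply [simp del] zero_fun_apply [simp del]

section \<open>Lowering operators on the vacuum module\<close>

definition acts :: "w22_basis list \<Rightarrow> functional \<Rightarrow> functional"
  where "acts w f = foldr act w f"

abbreviation W_word :: "int list \<Rightarrow> w22_basis list"
  where "W_word ks \<equiv> map (\<lambda>k. W (- k)) ks"

abbreviation L_word :: "int list \<Rightarrow> w22_basis list"
  where "L_word ks \<equiv> map (\<lambda>k. L (- k)) ks"

lemma acts_simps [simp]:
  "acts [] f = f" "acts (b # w) f = act b (acts w f)" "acts (v @ w) f = acts v (acts w f)"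
  by (simp_all add: acts_def)

lemma acts_linear [simp]:
  "acts w (f + g) = acts w f + acts w g" "acts w (fscale r f) = fscale r (acts w f)" "acts w 0 = 0"
  by (induction w) auto

lemma acts_in_dual [simp, intro]: "f \<in> w22_dual c \<Longrightarrow> acts w f \<in> w22_dual c"
  by (induction w) auto

lemma act_W_word: "f \<in> w22_dual c \<Longrightarrow> act (W m) (acts (W_word ks) f) = acts (W_word ks) (act (W m) f)"
proof (induction ks)
  case (Cons k ks)
  then show ?case using act_W_W[of "acts (W_word ks) f" c m "- k"] by simp
qed simp

lemma act_W_word_vac [simp]: "-1 \<le> m \<Longrightarrow> act (W m) (acts (W_word ks) (vac c)) = 0"
  by (simp add: act_W_word[where c = c])

lemma act_W_word_remove1:
  assumes "f \<in> w22_dual c" "n \<in> set ks"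
  shows "act (W (- n)) (acts (W_word (remove1 n ks)) f) = acts (W_word ks) f"
  using assms(2)
proof (induction ks)
  case (Cons k ks)
  then show ?case
    using act_W_W[of "acts (W_word (remove1 n ks)) f" c "- n" "- k"] assms(1) by auto
qed simp

text \<open>Moving \<open>L n\<close> past \<open>W (- k)\<close> produces \<open>W (n - k)\<close>
  of nonnegative index, which commutes with the remaining letters and kills the vacuum. Only the
  central terms survive, one for each \<open>k\<close> equal to \<open>n\<close>.\<close>

lemma act_L_W_word:
  assumes "\<forall>k\<in>set ks. k \<le> n" "-1 \<le> n"
  shows "act (L n) (acts (W_word ks) (vac c))
    = fscale (of_nat (count_list ks n) * cocycle c n) (acts (W_word (remove1 n ks)) (vac c))"
  using assms(1)
proof (induction ks)
  case (Cons k ks)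
  let ?g = "acts (W_word ks) (vac c)"
  have IH: "act (L n) ?g = fscale (of_nat (count_list ks n) * cocycle c n) (acts (W_word (remove1 n ks)) (vac c))"
    using Cons by simp
  have *: "act (L n) (act (W (- k)) ?g) = act (W (- k)) (act (L n) ?g)
      + fscale (if n = k then cocycle c n else 0) ?g"
    using act_L_W[of ?g c n "- k"] Cons.prems by simp
  show ?case
  proof (cases "k = n")
    case False
    then show ?thesis by (simp add: * IH)
  next
    case True
    note * = *[unfolded True]
    show ?thesis
    proof (cases "n \<in> set ks")
      case True
      then show ?thesis
        using \<open>k = n\<close> act_W_word_remove1[OF vac_in_dual, of n ks c]
        by (simp add: * IH distrib_right flip: fs.scale_left_distrib)
    next
      case False
      then have "count_list ks n = 0" by (simp add: count_list_0_iff)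
      then show ?thesis using \<open>k = n\<close> by (simp add: * IH)
    qed
  qed
qed (simp add: assms(2))

section \<open>Removing factors W by the operators L\<close>

definition decreasing :: "int list \<Rightarrow> bool"
  where "decreasing ks \<longleftrightarrow> sorted_wrt (\<ge>) ks \<and> (\<forall>k\<in>set ks. k > 1)"

lemma decreasing_simps [simp]:
  "decreasing []" "decreasing (k # ks) \<longleftrightarrow> k > 1 \<and> (\<forall>j\<in>set ks. j \<le> k) \<and> decreasing ks"
  by (auto simp: decreasing_def)

lemma cocycle_nonzero:
  assumes "c \<noteq> 0" "n > 1" shows "cocycle c n \<noteq> 0"
proof -
  have "n * ((n - 1) * (n + 1)) > 0" using assms(2) by simp
  moreover have "n ^ 3 - n = n * ((n - 1) * (n + 1))" by (simp add: algebra_simps power3_eq_cube)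
  ultimately have "n ^ 3 - n \<noteq> 0" by linarith
  then have "complex_of_int (n ^ 3 - n) \<noteq> 0" unfolding of_int_eq_0_iff .
  then show ?thesis using assms(1) unfolding cocycle_def by simp
qed

text \<open>The order on \<open>int list\<close> is the lexicographic one of \<open>List_Lexorder\<close>.\<close>

lemma lower_W_less:
  "decreasing ms \<Longrightarrow> decreasing ks \<Longrightarrow> ks < ms \<Longrightarrow>
    fold (\<lambda>m. act (L m)) ms (acts (W_word ks) (vac c)) = 0"
proof (induction ms arbitrary: ks)
  case (Cons m ms)
  have zero: "fold (\<lambda>m. act (L m)) ms 0 = 0" by (induction ms) auto
  have scale: "fold (\<lambda>m. act (L m)) ms (fscale r f) = fscale r (fold (\<lambda>m. act (L m)) ms f)" for r f
    by (induction ms arbitrary: f) auto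
  show ?case
  proof (cases ks)
    case Nil
    then show ?thesis using Cons.prems by (simp add: zero)
  next
    case (Cons k ks')
    \<comment> \<open>If the head is smaller, \<open>L m\<close> finds no factor to remove and gives
      0; if the heads agree, \<open>L m\<close> removes one and the comparison passes to the
      tails.\<close>
    then have le: "k < m \<or> k = m \<and> ks' < ms" using Cons.prems by simp
    then have "act (L m) (acts (W_word ks) (vac c))
        = fscale (of_nat (count_list ks m) * cocycle c m) (acts (W_word (remove1 m ks)) (vac c))"
      using Cons.prems Cons by (intro act_L_W_word) auto
    moreover have "k < m \<Longrightarrow> count_list ks m = 0"
      using Cons.prems Cons by (auto simp: count_list_0_iff)
    ultimately show ?thesis
      using le Cons Cons.IH[of ks'] Cons.prems by (auto simp: zero scale simp del: acts_simps)
  qed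
qed simp

text \<open>\<open>fold\<close> applies the operator of the head first, which is the largest entry,
  so the bound in \<open>act_L_W_word\<close> holds at every stage. Each stage contributes a
  positive multiplicity times a nonzero value of \<open>cocycle\<close>.\<close>

lemma lower_W_same:
  assumes "c \<noteq> 0" "decreasing ms"
  shows "\<exists>r. r \<noteq> 0 \<and> fold (\<lambda>m. act (L m)) ms (acts (W_word ms) (vac c)) = fscale r (vac c)"
  using assms(2)
proof (induction ms)
  case Nil
  have "fold (\<lambda>m. act (L m)) [] (acts (W_word []) (vac c)) = fscale 1 (vac c)" by simp
  then show ?case using zero_neq_one by metis
next
  case (Cons m ms)
  have scale: "fold (\<lambda>m. act (L m)) ms (fscale r f) = fscale r (fold (\<lambda>m. act (L m)) ms f)" for r f
    by (induction ms arbitrary: f) auto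
  obtain r where r: "r \<noteq> 0" "fold (\<lambda>m. act (L m)) ms (acts (W_word ms) (vac c)) = fscale r (vac c)"
    using Cons by auto
  let ?q = "of_nat (count_list (m # ms) m) * cocycle c m :: complex"
  have "act (L m) (acts (W_word (m # ms)) (vac c)) = fscale ?q (acts (W_word ms) (vac c))"
    using Cons.prems act_L_W_word[of "m # ms" m c] by simp
  then have "fold (\<lambda>m. act (L m)) (m # ms) (acts (W_word (m # ms)) (vac c)) = fscale (?q * r) (vac c)"
    by (simp add: scale r(2) del: acts_simps)
  moreover have "?q \<noteq> 0"
    using cocycle_nonzero[OF assms(1), of m] Cons.prems
    by (simp del: of_nat_Suc)
  ultimately show ?case using r(1) by (metis no_zero_divisors)
qed

text \<open>A monomial with \<open>t\<close> factors \<open>L\<close> is killed by \<open>t + 1\<close> operators \<open>W n\<close> with \<open>n \<ge> -1\<close>; the error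
  terms below are those that are killed one step earlier.\<close>

fun W_nil :: "complex \<Rightarrow> nat \<Rightarrow> functional set"
  where
    "W_nil c 0 = {0}"
  | "W_nil c (Suc t) = {f \<in> w22_dual c. \<forall>n\<ge>-1. act (W n) f \<in> W_nil c t}"

lemma subspace_W_nil: "fs.subspace (W_nil c t)"
  by (induction t) (auto simp: fs.subspace_def)

lemmas W_nil_closed [simp, intro] = fs.subspace_0[OF subspace_W_nil] fs.subspace_add[OF subspace_W_nil]
  fs.subspace_scale[OF subspace_W_nil]

lemma W_nil_dual: "f \<in> W_nil c t \<Longrightarrow> f \<in> w22_dual c"
  by (cases t) auto

lemma W_nil_Suc: "f \<in> W_nil c t \<Longrightarrow> f \<in> W_nil c (Suc t)"
  by (induction t arbitrary: f) auto

lemma W_nil_mono: "t \<le> t' \<Longrightarrow> f \<in> W_nil c t \<Longrightarrow> f \<in> W_nil c t'"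
  by (induction t' rule: dec_induct) (auto intro: W_nil_Suc simp del: W_nil.simps)

lemma act_W_nil_W: "f \<in> W_nil c t \<Longrightarrow> act (W j) f \<in> W_nil c t"
proof (induction t arbitrary: f)
  case (Suc t)
  then have "act (W n) (act (W j) f) \<in> W_nil c t" if "n \<ge> -1" for n
    using act_W_W[of f c n j] that by simp
  then show ?case using Suc.prems by simp
qed simp

text \<open>The commutator of \<open>W n\<close> with \<open>L j\<close> consists of
  \<open>W (n + j)\<close> and a scalar. Both preserve \<open>W_nil c t\<close>, even if
  \<open>n + j\<close> is below -1, since all \<open>W\<close> commute; so one factor
  \<open>L\<close> costs at most one more operator.\<close>

lemma act_W_nil_L: "f \<in> W_nil c t \<Longrightarrow> act (L j) f \<in> W_nil c (Suc t)"
proof (induction t arbitrary: f)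
  case (Suc t)
  have "act (W n) (act (L j) f) \<in> W_nil c (Suc t)" if "n \<ge> -1" for n
  proof -
    have "act (W n) f \<in> W_nil c t" using Suc.prems that by simp
    then have "act (L j) (act (W n) f) \<in> W_nil c (Suc t)" by (rule Suc.IH)
    moreover have "act (W n) (act (L j) f) = act (L j) (act (W n) f)
      + fscale (of_int (n - j)) (act (W (n + j)) f) + fscale (if n + j = 0 then cocycle c n else 0) f"
      using Suc.prems by (intro act_W_L) simp
    ultimately show ?thesis
      using act_W_nil_W[OF Suc.prems] Suc.prems by (simp del: W_nil.simps)
  qed
  moreover have "act (L j) f \<in> w22_dual c" using Suc.prems by auto
  ultimately show ?case by (simp only: W_nil.simps(2)[of c "Suc t"]) simp
qed simp

lemma vac_W_nil: "vac c \<in> W_nil c 1"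
  by simp

lemma L_word_W_nil: "acts (L_word ks) (vac c) \<in> W_nil c (Suc (length ks))"
proof (induction ks)
  case Nil
  show ?case using vac_W_nil by simp
next
  case (Cons k ks)
  then show ?case using act_W_nil_L by (simp del: W_nil.simps)
qed

lemma fold_W_nil: "f \<in> W_nil c (length ns) \<Longrightarrow> \<forall>n\<in>set ns. n \<ge> -1 \<Longrightarrow> fold (\<lambda>n. act (W n)) ns f = 0"
  by (induction ns arbitrary: f) auto

lemma fold_W_linear:
  "fold (\<lambda>n. act (W n)) ns (f + g) = fold (\<lambda>n. act (W n)) ns f + fold (\<lambda>n. act (W n)) ns g"
  "fold (\<lambda>n. act (W n)) ns (fscale r f) = fscale r (fold (\<lambda>n. act (W n)) ns f)"
  by (induction ns arbitrary: f g) auto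

text \<open>Moving \<open>W n\<close> to the right yields central terms, one for each
  \<open>k\<close> equal to \<open>n\<close>, and operators \<open>W (n - k)\<close> of nonnegative
  index, which go into the error \<open>z\<close>. As \<open>n\<close> bounds the decreasing list
  \<open>ks\<close>, all its copies stand in front, so removing any of them leaves
  \<open>tl ks\<close>.\<close>

lemma act_W_L_word:
  assumes "decreasing ks" "\<forall>k\<in>set ks. k \<le> n" "1 < n"
  shows "\<exists>z \<in> W_nil c (length ks - 1). act (W n) (acts (L_word ks) (vac c))
    = fscale (of_nat (count_list ks n) * cocycle c n) (acts (L_word (tl ks)) (vac c)) + z"
  using assms(1,2)
proof (induction ks)
  case Nil
  show ?case using assms(3) by (intro bexI[of _ 0]) auto
next
  case (Cons k ks)
  let ?g = "acts (L_word ks) (vac c)"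
  have *: "act (W n) (act (L (- k)) ?g) = act (L (- k)) (act (W n) ?g)
      + fscale (of_int (n + k)) (act (W (n - k)) ?g) + fscale (if n = k then cocycle c n else 0) ?g"
    using act_W_L[of ?g c n "- k"] by simp
  have z2: "act (W (n - k)) ?g \<in> W_nil c (length ks)"
    using L_word_W_nil[of ks c] Cons.prems by simp
  obtain z where z: "z \<in> W_nil c (length ks - 1)"
    "act (W n) ?g = fscale (of_nat (count_list ks n) * cocycle c n) (acts (L_word (tl ks)) (vac c)) + z"
    using Cons by auto
  \<comment> \<open>For empty \<open>ks\<close> the subtraction \<open>length ks - 1\<close> is
    truncated at 0 and \<open>act_W_nil_L\<close> would be off by one; there \<open>z\<close> is
    0.\<close>
  have z1: "act (L (- k)) z \<in> W_nil c (length ks)"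
  proof (cases ks)
    case Nil
    then show ?thesis using z(2) assms(3) by (simp del: W_nil.simps)
  next
    case (Cons j js)
    then show ?thesis using act_W_nil_L[OF z(1)] by (simp del: W_nil.simps)
  qed
  have eq: "fscale (of_nat (count_list ks n) * cocycle c n) (act (L (- k)) (acts (L_word (tl ks)) (vac c)))
      + fscale (if n = k then cocycle c n else 0) ?g
    = fscale (of_nat (count_list (k # ks) n) * cocycle c n) ?g"
  proof (cases "count_list ks n = 0")
    case True
    then show ?thesis by (cases "k = n") auto
  next
    case False
    then have "n \<in> set ks" by (simp add: count_list_0_iff)
    then have "k = n" "ks \<noteq> []" using Cons.prems by auto
    moreover have "hd ks = n"
      using \<open>n \<in> set ks\<close> Cons.prems by (cases ks) auto
    ultimately have "act (L (- k)) (acts (L_word (tl ks)) (vac c)) = ?g" by (cases ks) auto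
    then show ?thesis using \<open>k = n\<close> by (simp add: distrib_right flip: fs.scale_left_distrib)
  qed
  show ?case
  proof (rule bexI)
    show "act (L (- k)) z + fscale (of_int (n + k)) (act (W (n - k)) ?g) \<in> W_nil c (length (k # ks) - 1)"
      using z1 z2 by (simp del: W_nil.simps)
    have "act (W n) (act (L (- k)) ?g)
      = (fscale (of_nat (count_list ks n) * cocycle c n) (act (L (- k)) (acts (L_word (tl ks)) (vac c)))
      + fscale (if n = k then cocycle c n else 0) ?g)
      + (act (L (- k)) z + fscale (of_int (n + k)) (act (W (n - k)) ?g))"
      unfolding * z(2) by (simp add: algebra_simps)
    then show "act (W n) (acts (L_word (k # ks)) (vac c))
      = fscale (of_nat (count_list (k # ks) n) * cocycle c n) (acts (L_word (tl (k # ks))) (vac c))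
      + (act (L (- k)) z + fscale (of_int (n + k)) (act (W (n - k)) ?g))"
      unfolding eq by simp
  qed
qed

text \<open>A word with fewer factors is killed by \<open>length ns\<close> operators, whatever its
  entries. For equal lengths the head of \<open>ns\<close> either meets no equal entry or removes
  one, and the error term it leaves has as many operators against it as it needs to vanish.\<close>

lemma lower_L_less:
  "decreasing ns \<Longrightarrow> decreasing ks \<Longrightarrow> (length ks, ks) < (length ns, ns) \<Longrightarrow>
    fold (\<lambda>n. act (W n)) ns (acts (L_word ks) (vac c)) = 0"
proof (induction ns arbitrary: ks)
  case (Cons n ns)
  have ge: "\<forall>m\<in>set ns. m \<ge> -1" using Cons.prems(1) by (auto simp: decreasing_def)
  show ?case
  proof (cases "length ks < length (n # ns)")
    case True
    then have "acts (L_word ks) (vac c) \<in> W_nil c (length (n # ns))"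
      using W_nil_mono[OF _ L_word_W_nil[of ks c]] by (simp del: W_nil.simps)
    then show ?thesis
      using fold_W_nil[of "acts (L_word ks) (vac c)" c "n # ns"] ge Cons.prems(1) by simp
  next
    case False
    then have len: "length ks = length (n # ns)" and less: "ks < n # ns" using Cons.prems by auto
    then obtain k ks' where ks: "ks = k # ks'" by (cases ks) auto
    have le: "k < n \<or> k = n \<and> ks' < ns" using less ks by simp
    have bound: "\<forall>j\<in>set ks. j \<le> n" using le ks Cons.prems(2) by fastforce
    obtain z where z: "z \<in> W_nil c (length ks - 1)" "act (W n) (acts (L_word ks) (vac c))
        = fscale (of_nat (count_list ks n) * cocycle c n) (acts (L_word (tl ks)) (vac c)) + z"
      using act_W_L_word[OF Cons.prems(2) bound, of c] Cons.prems(1) by auto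
    have "fold (\<lambda>n. act (W n)) ns z = 0"
      using z(1) len ge by (intro fold_W_nil) auto
    moreover have "k < n \<Longrightarrow> count_list ks n = 0"
      using Cons.prems ks by (auto simp: count_list_0_iff)
    moreover have "k = n \<Longrightarrow> fold (\<lambda>n. act (W n)) ns (acts (L_word ks') (vac c)) = 0"
      using le ks len Cons.prems by (intro Cons.IH) auto
    moreover have "fold (\<lambda>n. act (W n)) (n # ns) (acts (L_word ks) (vac c))
        = fscale (of_nat (count_list ks n) * cocycle c n)
            (fold (\<lambda>n. act (W n)) ns (acts (L_word (tl ks)) (vac c)))
          + fold (\<lambda>n. act (W n)) ns z"
      by (simp add: z(2) fold_W_linear)
    ultimately show ?thesis using le ks by auto
  qed
qed simp

lemma lower_L_same:
  assumes "c \<noteq> 0" "decreasing ns"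
  shows "\<exists>r. r \<noteq> 0 \<and> fold (\<lambda>n. act (W n)) ns (acts (L_word ns) (vac c)) = fscale r (vac c)"
  using assms(2)
proof (induction ns)
  case Nil
  have "fold (\<lambda>m. act (W m)) [] (acts (L_word []) (vac c)) = fscale 1 (vac c)" by simp
  then show ?case using zero_neq_one by metis
next
  case (Cons n ns)
  obtain r where r: "r \<noteq> 0" "fold (\<lambda>n. act (W n)) ns (acts (L_word ns) (vac c)) = fscale r (vac c)"
    using Cons by auto
  let ?q = "of_nat (count_list (n # ns) n) * cocycle c n :: complex"
  obtain z where z: "z \<in> W_nil c (length ns)"
    "act (W n) (acts (L_word (n # ns)) (vac c)) = fscale ?q (acts (L_word ns) (vac c)) + z"
    using act_W_L_word[of "n # ns" n c] Cons.prems by auto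
  have "fold (\<lambda>n. act (W n)) ns z = 0"
    using z(1) Cons.prems by (intro fold_W_nil) (auto simp: decreasing_def)
  then have "fold (\<lambda>n. act (W n)) (n # ns) (acts (L_word (n # ns)) (vac c)) = fscale (?q * r) (vac c)"
    using z(2) by (simp add: fold_W_linear r(2))
  moreover have "?q \<noteq> 0"
    using cocycle_nonzero[OF assms(1), of n] Cons.prems
    by (simp del: of_nat_Suc)
  ultimately show ?case using r(1) by (metis no_zero_divisors)
qed

section \<open>Lowering mixed monomials\<close>

lemma fold_W_W_word:
  "f \<in> w22_dual c \<Longrightarrow>
    fold (\<lambda>n. act (W n)) ns (acts (W_word ks) f) = acts (W_word ks) (fold (\<lambda>n. act (W n)) ns f)"
  by (induction ns arbitrary: f) (simp_all add: act_W_word)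

text \<open>The \<open>W\<close> operators come first: they pass through the \<open>W\<close>
  letters and strip the \<open>L\<close> letters. After that the \<open>L\<close> operators face a
  word in \<open>W\<close> letters only.\<close>

definition lower :: "int list \<Rightarrow> int list \<Rightarrow> functional \<Rightarrow> functional"
  where "lower ms ns f = fold (\<lambda>m. act (L m)) ms (fold (\<lambda>n. act (W n)) ns f)"

definition pbw_word :: "int list \<Rightarrow> int list \<Rightarrow> w22_basis list"
  where "pbw_word ms ns = W_word ms @ L_word ns"

lemma lower_less:
  assumes "c \<noteq> 0" "decreasing ms" "decreasing ns" "decreasing ks" "decreasing ls"
    "(length ls, ls, ks) < (length ns, ns, ms)"
  shows "lower ms ns (acts (pbw_word ks ls) (vac c)) = 0"
proof -
  have zero: "fold (\<lambda>m. act (L m)) ms 0 = 0" by (induction ms) auto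
  have scale: "fold (\<lambda>m. act (L m)) ms (fscale r f) = fscale r (fold (\<lambda>m. act (L m)) ms f)" for r f
    by (induction ms arbitrary: f) auto
  have *: "lower ms ns (acts (pbw_word ks ls) (vac c))
      = fold (\<lambda>m. act (L m)) ms (acts (W_word ks) (fold (\<lambda>n. act (W n)) ns (acts (L_word ls) (vac c))))"
    by (simp add: lower_def pbw_word_def fold_W_W_word[where c = c])
  show ?thesis
  \<comment> \<open>If the \<open>L\<close> parts agree, the \<open>W\<close> operators turn them
    into a nonzero multiple of the vacuum and the comparison is decided by \<open>ks < ms\<close>;
    otherwise they already give 0.\<close>
  proof (cases "ls = ns")
    case True
    obtain r where "fold (\<lambda>n. act (W n)) ns (acts (L_word ns) (vac c)) = fscale r (vac c)"
      using lower_L_same assms by blast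
    then show ?thesis using True assms lower_W_less[of ms ks c] unfolding * by (simp add: scale)
  next
    case False
    then have "(length ls, ls) < (length ns, ns)" using assms(6) by auto
    then show ?thesis using assms lower_L_less[of ns ls c] unfolding * by (simp add: zero)
  qed
qed

lemma lower_same:
  assumes "c \<noteq> 0" "decreasing ms" "decreasing ns"
  shows "\<exists>r. r \<noteq> 0 \<and> lower ms ns (acts (pbw_word ms ns) (vac c)) = fscale r (vac c)"
proof -
  have scale: "fold (\<lambda>m. act (L m)) ms (fscale r f) = fscale r (fold (\<lambda>m. act (L m)) ms f)" for r f
    by (induction ms arbitrary: f) auto
  obtain r s where r: "fold (\<lambda>n. act (W n)) ns (acts (L_word ns) (vac c)) = fscale r (vac c)"
    and s: "fold (\<lambda>m. act (L m)) ms (acts (W_word ms) (vac c)) = fscale s (vac c)" and "r \<noteq> 0" "s \<noteq> 0"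
    using lower_L_same[OF assms(1,3)] lower_W_same[OF assms(1,2)] by blast
  then have "lower ms ns (acts (pbw_word ms ns) (vac c)) = fscale (r * s) (vac c)"
    by (simp add: lower_def pbw_word_def fold_W_W_word[where c = c] scale)
  then show ?thesis using \<open>r \<noteq> 0\<close> \<open>s \<noteq> 0\<close> by (metis no_zero_divisors)
qed

section \<open>The tensor algebra\<close>

abbreviation word :: "'b list \<Rightarrow> ('b list \<Rightarrow>\<^sub>0 complex)"
  where "word w \<equiv> Poly_Mapping.single w 1"

abbreviation tensor_mult :: "('b list \<Rightarrow>\<^sub>0 complex) \<Rightarrow> ('b list \<Rightarrow>\<^sub>0 complex) \<Rightarrow> ('b list \<Rightarrow>\<^sub>0 complex)"
    (infixl "\<star>" 70)
  where "x \<star> y \<equiv> bilinear_ext (\<lambda>u v. word (u @ v)) x y"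

lemma tensor_algebra_simps [simp]:
  "carrier tensor_algebra = UNIV" "mult tensor_algebra = (\<star>)" "one tensor_algebra = word []"
  "zero tensor_algebra = 0" "add tensor_algebra = (+)"
  by (simp_all add: tensor_algebra_def)

lemmas tensor_bilinear =
  bilinear_ext_add_left[of "\<lambda>u v. word (u @ v)"] bilinear_ext_add_right[of "\<lambda>u v. word (u @ v)"]
  bilinear_ext_scale_left[of "\<lambda>u v. word (u @ v)"] bilinear_ext_scale_right[of "\<lambda>u v. word (u @ v)"]

lemma tensor_assoc: "(x \<star> y) \<star> z = x \<star> (y \<star> z)"
proof (induction x rule: poly_mapping_linear_induct)
  case (single u)
  show ?case
  proof (induction y rule: poly_mapping_linear_induct)
    case (single v)
    show ?case
      by (induction z rule: poly_mapping_linear_induct) (simp_all add: tensor_bilinear)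
  qed (simp_all add: tensor_bilinear)
qed (simp_all add: tensor_bilinear)

lemma tensor_one [simp]: "word [] \<star> x = x" "x \<star> word [] = x"
  by (induction x rule: poly_mapping_linear_induct) (simp_all add: tensor_bilinear)

lemma tensor_scalar [simp]: "Poly_Mapping.single [] r \<star> x = scale r x"
  by (induction x rule: poly_mapping_linear_induct)
    (simp_all add: tensor_bilinear pm.scale_right_distrib mult.commute)

lemma ring_tensor_algebra: "ring (tensor_algebra :: ('b list \<Rightarrow>\<^sub>0 complex) ring)"
proof (rule ringI)
  show "abelian_group (tensor_algebra :: ('b list \<Rightarrow>\<^sub>0 complex) ring)"
    by (rule abelian_groupI) (auto simp: algebra_simps intro: exI[of _ "- x" for x] left_minus)
  show "monoid (tensor_algebra :: ('b list \<Rightarrow>\<^sub>0 complex) ring)"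
    by (rule monoidI) (auto simp: tensor_assoc)
qed (auto simp: tensor_bilinear)

lemma tensor_minus [simp]: "\<ominus>\<^bsub>tensor_algebra\<^esub> x = - x"
proof -
  interpret ring "tensor_algebra :: ('b list \<Rightarrow>\<^sub>0 complex) ring" by (rule ring_tensor_algebra)
  show ?thesis using minus_equality[of "- x" x] by simp
qed

definition left_ideal :: "('b list \<Rightarrow>\<^sub>0 complex) set \<Rightarrow> bool"
  where "left_ideal N \<longleftrightarrow> 0 \<in> N \<and> (\<forall>x\<in>N. \<forall>y\<in>N. x + y \<in> N) \<and> (\<forall>x\<in>N. \<forall>y. y \<star> x \<in> N)"

lemma left_ideal_mult: "left_ideal N \<Longrightarrow> x \<in> N \<Longrightarrow> y \<star> x \<in> N"
  by (simp add: left_ideal_def)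

lemma left_ideal_subspace: "left_ideal N \<Longrightarrow> pm.subspace N"
  unfolding left_ideal_def pm.subspace_def by (metis tensor_scalar)

lemma left_ideal_span: "left_ideal N \<Longrightarrow> pm.span N = N"
  by (simp add: left_ideal_subspace)

lemma tensor_mult_span:
  assumes "x \<in> pm.span S" "\<And>s. s \<in> S \<Longrightarrow> y \<star> s \<in> pm.span S'"
  shows "y \<star> x \<in> pm.span S'"
  using assms(1)
  by (induction rule: pm.span_induct_alt)
    (auto simp: tensor_bilinear intro: pm.span_add pm.span_scale pm.span_zero assms(2))

section \<open>The action of the tensor algebra on functionals\<close>

definition app :: "(w22_basis list \<Rightarrow>\<^sub>0 complex) \<Rightarrow> functional \<Rightarrow> functional"
  where "app x f = lin_ext fscale (\<lambda>w. acts w f) x"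

lemma app_linear [simp]:
  "app (x + y) f = app x f + app y f" "app (x - y) f = app x f - app y f"
  "app (scale r x) f = fscale r (app x f)" "app 0 f = 0" "app (sum g S) f = (\<Sum>a\<in>S. app (g a) f)"
  "app (Poly_Mapping.single w r) f = fscale r (acts w f)"
proof -
  interpret Vector_Spaces.linear scale fscale "\<lambda>x. app x f"
    unfolding app_def by (rule linear_lin_ext[OF fs.vector_space_axioms])
  show "app (x + y) f = app x f + app y f" "app (x - y) f = app x f - app y f"
    "app (scale r x) f = fscale r (app x f)" "app 0 f = 0" "app (sum g S) f = (\<Sum>a\<in>S. app (g a) f)"
    by (rule add, rule diff, rule scale, rule zero, rule sum)
  show "app (Poly_Mapping.single w r) f = fscale r (acts w f)"
    by (simp add: app_def lin_ext_single[OF fs.vector_space_axioms])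
qed

lemma app_mult: "app (x \<star> y) f = app x (app y f)"
proof (induction x rule: poly_mapping_linear_induct)
  case (single u)
  show ?case
    by (induction y rule: poly_mapping_linear_induct) (simp_all add: tensor_bilinear)
qed (simp_all add: tensor_bilinear)

lemma app_zero [simp]: "app x 0 = 0"
  by (induction x rule: poly_mapping_linear_induct) simp_all

lemma app_in_dual: "f \<in> w22_dual c \<Longrightarrow> app x f \<in> w22_dual c"
  by (induction x rule: poly_mapping_linear_induct) auto

lemma tensor_embed_lin_ext: "tensor_embed x = lin_ext scale (\<lambda>b. word [b]) x"
  by (simp add: tensor_embed_def lin_ext_def)

lemma tensor_embed_linear [simp]:
  "tensor_embed (x + y) = tensor_embed x + tensor_embed y"
  "tensor_embed (scale r x) = scale r (tensor_embed x)"
  "tensor_embed (Poly_Mapping.single b r) = Poly_Mapping.single [b] r"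
  for x y :: "'b \<Rightarrow>\<^sub>0 complex"
proof -
  interpret Vector_Spaces.linear scale scale "tensor_embed :: ('b \<Rightarrow>\<^sub>0 complex) \<Rightarrow> _"
    unfolding tensor_embed_lin_ext[abs_def] by (rule linear_lin_ext[OF pm.vector_space_axioms])
  show "tensor_embed (x + y) = tensor_embed x + tensor_embed y"
    "tensor_embed (scale r x) = scale r (tensor_embed x)"
    by (rule add, rule scale)
  show "tensor_embed (Poly_Mapping.single b r) = Poly_Mapping.single [b] r"
    by (simp add: tensor_embed_lin_ext lin_ext_single[OF pm.vector_space_axioms])
qed

lemma app_tensor_embed: "app (tensor_embed x) f w = lin_ext (*) (\<lambda>d. act d f w) x"
  by (induction x rule: poly_mapping_linear_induct)
    (simp_all add: lin_ext_complex_simps plus_fun_apply fscale_apply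
      module_hom.scale[OF module_hom_linearI, OF linear_lin_ext[OF vector_space_complex]])

abbreviation w22_ideal :: "(w22_basis list \<Rightarrow>\<^sub>0 complex) set"
  where "w22_ideal \<equiv> enveloping_ideal w22_bracket"

lemma ideal_enveloping_ideal: "ideal (enveloping_ideal br) tensor_algebra"
  unfolding enveloping_ideal_def
  by (rule ring.genideal_ideal[OF ring_tensor_algebra]) simp

lemma enveloping_ideal_closed:
  shows enveloping_ideal_zero: "0 \<in> enveloping_ideal br"
    and enveloping_ideal_add: "x \<in> enveloping_ideal br \<Longrightarrow> y \<in> enveloping_ideal br \<Longrightarrow> x + y \<in> enveloping_ideal br"
    and enveloping_ideal_left: "x \<in> enveloping_ideal br \<Longrightarrow> y \<star> x \<in> enveloping_ideal br"
    and enveloping_ideal_right: "x \<in> enveloping_ideal br \<Longrightarrow> x \<star> y \<in> enveloping_ideal br"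
proof -
  interpret ideal "enveloping_ideal br" tensor_algebra by (rule ideal_enveloping_ideal)
  show "0 \<in> enveloping_ideal br" using additive_subgroup.zero_closed[OF is_additive_subgroup] by simp
  show "x \<in> enveloping_ideal br \<Longrightarrow> y \<in> enveloping_ideal br \<Longrightarrow> x + y \<in> enveloping_ideal br"
    using additive_subgroup.a_closed[OF is_additive_subgroup, of x y] by simp
  show "x \<in> enveloping_ideal br \<Longrightarrow> y \<star> x \<in> enveloping_ideal br"
    using I_l_closed[of x y] by simp
  show "x \<in> enveloping_ideal br \<Longrightarrow> x \<star> y \<in> enveloping_ideal br"
    using I_r_closed[of x y] by simp
qed

lemma enveloping_ideal_generator:
  "tensor_embed x \<star> tensor_embed y - tensor_embed y \<star> tensor_embed x - tensor_embed (br x y)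
    \<in> enveloping_ideal br"
  unfolding enveloping_ideal_def
  by (rule subsetD[OF ring.genideal_self[OF ring_tensor_algebra]]) auto

lemma enveloping_ideal_minimal:
  assumes "ideal K tensor_algebra"
    "\<And>x y. tensor_embed x \<star> tensor_embed y - tensor_embed y \<star> tensor_embed x - tensor_embed (br x y) \<in> K"
  shows "enveloping_ideal br \<subseteq> K"
  unfolding enveloping_ideal_def
  by (rule ring.genideal_minimal[OF ring_tensor_algebra assms(1)]) (use assms(2) in auto)

lemma w22_ideal_commutator:
  "word [a, b] - word [b, a] - tensor_embed (w22_basis_bracket a b) \<in> w22_ideal"
  using enveloping_ideal_generator[of "Poly_Mapping.single a 1" "Poly_Mapping.single b 1" w22_bracket] by simp

lemma app_w22_ideal:
  assumes "x \<in> w22_ideal" "f \<in> w22_dual c"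
  shows "app x f = 0"
proof -
  \<comment> \<open>Annihilating all of \<open>w22_dual c\<close>, and not just
    \<open>vac c\<close>, makes this a two-sided ideal, because \<open>w22_dual c\<close> is stable
    under \<open>app\<close>.\<close>
  let ?K = "{x. \<forall>f\<in>w22_dual c. app x f = 0}"
  have "w22_ideal \<subseteq> ?K"
  proof (rule enveloping_ideal_minimal)
    interpret ring "tensor_algebra :: (w22_basis list \<Rightarrow>\<^sub>0 complex) ring" by (rule ring_tensor_algebra)
    show "ideal ?K tensor_algebra"
    proof (rule idealI[OF ring_axioms])
      show "subgroup ?K (add_monoid tensor_algebra)"
        using add.subgroupI[of ?K] by (auto simp: simp flip: a_inv_def)
          (metis app_linear(2) app_linear(4) diff_0 diff_zero)
    qed (auto simp: app_mult app_in_dual)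
  next
    fix x y
    show "tensor_embed x \<star> tensor_embed y - tensor_embed y \<star> tensor_embed x
      - tensor_embed (w22_bracket x y) \<in> ?K"
    proof (induction x rule: poly_mapping_linear_induct)
      case (single a)
      show ?case
      proof (induction y rule: poly_mapping_linear_induct)
        case (single b)
        have "app (tensor_embed (w22_basis_bracket a b)) f = act a (act b f) - act b (act a f)"
          if "f \<in> w22_dual c" for f
          using dual_act_commutator[OF that, of a b] by (simp add: fun_eq_iff app_tensor_embed)
        then show ?case by simp
      qed (auto simp: tensor_bilinear w22_bracket_bilinear algebra_simps simp flip: fs.scale_right_diff_distrib)
    qed (auto simp: tensor_bilinear w22_bracket_bilinear algebra_simps simp flip: fs.scale_right_diff_distrib)
  qed
  then show ?thesis using assms by blast
qed

section \<open>Spanning sets modulo left ideals\<close>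

definition weight :: "w22_basis list \<Rightarrow> int"
  where "weight w = (\<Sum>b\<leftarrow>w. basis_index b)"

lemma weight_simps [simp]: "weight [] = 0" "weight (b # w) = basis_index b + weight w"
  by (simp_all add: weight_def)

lemma keys_w22_basis_bracket:
  "d \<in> Poly_Mapping.keys (w22_basis_bracket a b) \<Longrightarrow> basis_index d = basis_index a + basis_index b"
  by (cases a; cases b) (auto simp: w22_central_def lookup_add lookup_single when_def in_keys_iff split: if_splits)

lemma w22_ideal_swap:
  "word (a # b # w) - word (b # a # w)
    - (\<Sum>d\<in>Poly_Mapping.keys (w22_basis_bracket a b).
        scale (Poly_Mapping.lookup (w22_basis_bracket a b) d) (word (d # w))) \<in> w22_ideal"
proof -
  have "(word [a, b] - word [b, a] - tensor_embed (w22_basis_bracket a b)) \<star> word w \<in> w22_ideal"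
    by (intro enveloping_ideal_right w22_ideal_commutator)
  then show ?thesis
    by (simp add: bilinear_ext_diff_left tensor_embed_lin_ext lin_ext_def bilinear_ext_sum_left
        bilinear_ext_scale_left del: scale_single)
qed

lemma word_swap_span:
  assumes "w22_ideal \<subseteq> H" "word (b # a # w) \<in> pm.span (H \<union> S)"
    "\<And>d. d \<in> Poly_Mapping.keys (w22_basis_bracket a b) \<Longrightarrow> word (d # w) \<in> pm.span (H \<union> S)"
  shows "word (a # b # w) \<in> pm.span (H \<union> S)"
proof -
  let ?s = "\<Sum>d\<in>Poly_Mapping.keys (w22_basis_bracket a b).
        scale (Poly_Mapping.lookup (w22_basis_bracket a b) d) (word (d # w))"
  have "word (a # b # w) = (word (a # b # w) - word (b # a # w) - ?s) + word (b # a # w) + ?s"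
    by simp
  also have "\<dots> \<in> pm.span (H \<union> S)"
    using w22_ideal_swap[of a b w] assms(1)
    by (intro pm.span_add pm.span_sum pm.span_scale assms) (auto intro: pm.span_base)
  finally show ?thesis .
qed

text \<open>\<open>X\<close> stands for the letters that cannot be discarded: those of negative
  index in the Verma module, and those of index at most -2 modulo J. The weight is recorded in order
  to separate the vacuum line in the Verma module.\<close>

definition weight_words :: "w22_basis set \<Rightarrow> int \<Rightarrow> (w22_basis list \<Rightarrow>\<^sub>0 complex) set"
  where "weight_words X k = {word w |w. w \<in> lists X \<and> weight w = k}"

lemma weight_wordsI: "w \<in> lists X \<Longrightarrow> weight w = k \<Longrightarrow> word w \<in> weight_words X k"
  unfolding weight_words_def by blast

context
  fixes H :: "(w22_basis list \<Rightarrow>\<^sub>0 complex) set" and X :: "w22_basis set"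
  assumes H: "left_ideal H" "w22_ideal \<subseteq> H"
    and non_X: "\<And>b. b \<notin> X \<Longrightarrow> \<exists>r. word [b] - scale r (word []) \<in> H \<and> (basis_index b \<noteq> 0 \<longrightarrow> r = 0)"
begin

lemma letter_weight_word_span:
  assumes "x \<in> pm.span (H \<union> weight_words X k)" "y \<in> X"
  shows "word [y] \<star> x \<in> pm.span (H \<union> weight_words X (basis_index y + k))"
proof (rule tensor_mult_span[OF assms(1)])
  fix s assume "s \<in> H \<union> weight_words X k"
  then show "word [y] \<star> s \<in> pm.span (H \<union> weight_words X (basis_index y + k))"
  proof
    assume "s \<in> H"
    then show ?thesis using H(1) by (auto intro!: pm.span_base left_ideal_mult)
  next
    assume "s \<in> weight_words X k"
    then obtain w where "w \<in> lists X" "weight w = k" "s = word w" unfolding weight_words_def by blast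
    then show ?thesis using assms(2) by (auto intro!: pm.span_base weight_wordsI)
  qed
qed

text \<open>A letter outside \<open>X\<close> is moved to the right end, where it becomes a scalar
  modulo \<open>H\<close>; the commutators met on the way are shorter words. Brackets add indices,
  and a nonzero scalar replaces only letters of index 0, so the weight does not change.\<close>

lemma letter_word_span:
  "w \<in> lists X \<Longrightarrow> word (b # w) \<in> pm.span (H \<union> weight_words X (basis_index b + weight w))"
proof (induction w arbitrary: b)
  case Nil
  show ?case
  proof (cases "b \<in> X")
    case True
    then show ?thesis by (intro pm.span_base) (auto intro!: weight_wordsI)
  next
    case False
    then obtain r where r: "word [b] - scale r (word []) \<in> H" "basis_index b \<noteq> 0 \<longrightarrow> r = 0"
      using non_X by blast
    have "scale r (word []) \<in> pm.span (H \<union> weight_words X (basis_index b))"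
    proof (cases "basis_index b = 0")
      case True
      then have "word [] \<in> pm.span (H \<union> weight_words X (basis_index b))"
        by (intro pm.span_base) (auto intro!: weight_wordsI)
      then show ?thesis by (rule pm.span_scale)
    qed (use r(2) in \<open>simp add: pm.span_zero\<close>)
    then have "(word [b] - scale r (word [])) + scale r (word []) \<in> pm.span (H \<union> weight_words X (basis_index b))"
      using r(1) by (intro pm.span_add pm.span_base[of "word [b] - scale r (word [])"]) simp_all
    then show ?thesis by simp
  qed
next
  case (Cons y w)
  show ?case
  proof (cases "b \<in> X")
    case True
    then show ?thesis using Cons.prems
      by (intro pm.span_base) (auto intro!: weight_wordsI)
  next
    case False
    have "word (y # b # w) \<in> pm.span (H \<union> weight_words X (basis_index y + (basis_index b + weight w)))"
      using letter_weight_word_span[OF Cons.IH[of b], of y] Cons.prems by simp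
    then have 1: "word (y # b # w) \<in> pm.span (H \<union> weight_words X (basis_index b + weight (y # w)))"
      by (simp add: ac_simps)
    have 2: "word (d # w) \<in> pm.span (H \<union> weight_words X (basis_index b + weight (y # w)))"
      if "d \<in> Poly_Mapping.keys (w22_basis_bracket b y)" for d
      using Cons.IH[of d] Cons.prems keys_w22_basis_bracket[OF that] by (simp add: ac_simps)
    show ?thesis by (rule word_swap_span[OF H(2) 1 2])
  qed
qed

lemma word_span: "word w \<in> pm.span (H \<union> weight_words X (weight w))"
proof (induction w)
  case Nil
  show ?case by (intro pm.span_base) (auto intro!: weight_wordsI)
next
  case (Cons b w)
  have "word [b] \<star> word w \<in> pm.span (H \<union> weight_words X (basis_index b + weight w))"
  proof (rule tensor_mult_span[OF Cons.IH])
    fix s assume "s \<in> H \<union> weight_words X (weight w)"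
    then show "word [b] \<star> s \<in> pm.span (H \<union> weight_words X (basis_index b + weight w))"
    proof
      assume "s \<in> H"
      then show ?thesis using H(1) by (auto intro!: pm.span_base left_ideal_mult)
    next
      assume "s \<in> weight_words X (weight w)"
      then obtain v where "v \<in> lists X" "weight v = weight w" "s = word v"
        unfolding weight_words_def by blast
      then show ?thesis using letter_word_span[of v b] by simp
    qed
  qed
  then show ?case by simp
qed

end

section \<open>Sorting words in letters of index at most -2\<close>

fun letter_le :: "w22_basis \<Rightarrow> w22_basis \<Rightarrow> bool"
  where
    "letter_le (W m) (W n) \<longleftrightarrow> m \<le> n"
  | "letter_le (W m) (L n) \<longleftrightarrow> True"
  | "letter_le (L m) (L n) \<longleftrightarrow> m \<le> n"
  | "letter_le _ _ \<longleftrightarrow> False"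

lemma letter_le_linear: "a \<noteq> C \<Longrightarrow> b \<noteq> C \<Longrightarrow> letter_le a b \<or> letter_le b a"
  by (cases a; cases b) auto

lemma letter_le_trans: "letter_le a b \<Longrightarrow> letter_le b d \<Longrightarrow> letter_le a d"
  by (cases a; cases b; cases d) auto

definition low_letters :: "w22_basis set"
  where "low_letters = {b. basis_index b \<le> -2}"

lemma low_letters_not_C: "b \<in> low_letters \<Longrightarrow> b \<noteq> C"
  by (auto simp: low_letters_def)

lemma low_letters_bracket:
  "a \<in> low_letters \<Longrightarrow> b \<in> low_letters \<Longrightarrow> d \<in> Poly_Mapping.keys (w22_basis_bracket a b) \<Longrightarrow> d \<in> low_letters"
  using keys_w22_basis_bracket[of d a b] by (auto simp: low_letters_def)

definition sorted_words :: "nat \<Rightarrow> (w22_basis list \<Rightarrow>\<^sub>0 complex) set"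
  where "sorted_words n = {word w |w. w \<in> lists low_letters \<and> sorted_wrt letter_le w \<and> length w \<le> n}"

lemma sorted_wordsI:
  "w \<in> lists low_letters \<Longrightarrow> sorted_wrt letter_le w \<Longrightarrow> length w \<le> n \<Longrightarrow> word w \<in> sorted_words n"
  unfolding sorted_words_def by blast

lemma span_sorted_mono: "n \<le> n' \<Longrightarrow> x \<in> pm.span (H \<union> sorted_words n) \<Longrightarrow> x \<in> pm.span (H \<union> sorted_words n')"
  by (rule subsetD[OF pm.span_mono]) (auto simp: sorted_words_def)

context
  fixes H :: "(w22_basis list \<Rightarrow>\<^sub>0 complex) set"
  assumes H: "left_ideal H" "w22_ideal \<subseteq> H"
begin

text \<open>Straightening: if \<open>b\<close> has to pass the head \<open>z\<close>, it is inserted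
  into the tail and the commutator terms are shorter words in low letters. The set of
  \<open>v\<close> is recorded so that \<open>z # v\<close> is seen to be sorted.\<close>

lemma insert_sorted:
  "w \<in> lists low_letters \<Longrightarrow> sorted_wrt letter_le w \<Longrightarrow> b \<in> low_letters \<Longrightarrow>
    \<exists>v. v \<in> lists low_letters \<and> sorted_wrt letter_le v \<and> set v = insert b (set w) \<and> length v = Suc (length w) \<and>
      word (b # w) - word v \<in> pm.span (H \<union> sorted_words (length w))"
proof (induction "length w" arbitrary: w b rule: less_induct)
  case less
  \<comment> \<open>The error of inserting into the tail stands behind \<open>z\<close>. Multiplied
    by \<open>z\<close> it has to be sorted once more, which the induction hypothesis allows for
    lengths below that of \<open>w\<close>.\<close>
  have stable: "word [z] \<star> x \<in> pm.span (H \<union> sorted_words (Suc n))"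
    if x: "x \<in> pm.span (H \<union> sorted_words n)" and z: "z \<in> low_letters" and n: "n < length w" for x z n
  proof (rule tensor_mult_span[OF x])
    fix s assume "s \<in> H \<union> sorted_words n"
    then show "word [z] \<star> s \<in> pm.span (H \<union> sorted_words (Suc n))"
    proof
      assume "s \<in> H"
      then show ?thesis using H(1) by (auto intro!: pm.span_base left_ideal_mult)
    next
      assume "s \<in> sorted_words n"
      then obtain u where u: "s = word u" "u \<in> lists low_letters" "sorted_wrt letter_le u" "length u \<le> n"
        unfolding sorted_words_def by blast
      obtain v where v: "v \<in> lists low_letters" "sorted_wrt letter_le v" "length v = Suc (length u)"
        "word (z # u) - word v \<in> pm.span (H \<union> sorted_words (length u))"
        using less.hyps[of u z] u z n by auto
      have "word v \<in> pm.span (H \<union> sorted_words (Suc n))"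
        using v u by (intro pm.span_base) (auto intro!: sorted_wordsI)
      moreover have "word (z # u) - word v \<in> pm.span (H \<union> sorted_words (Suc n))"
        by (rule span_sorted_mono[OF _ v(4)]) (use u in simp)
      ultimately have "word (z # u) - word v + word v \<in> pm.span (H \<union> sorted_words (Suc n))"
        by (rule pm.span_add[rotated])
      then show ?thesis using u(1) by simp
    qed
  qed
  show ?case
  proof (cases "w = [] \<or> letter_le b (hd w)")
    case True
    then have "sorted_wrt letter_le (b # w)"
      using less.prems by (cases w) (auto intro: letter_le_trans)
    then show ?thesis
      using less.prems by (intro exI[of _ "b # w"]) (auto simp: pm.span_zero)
  next
    case False
    then obtain z u where w: "w = z # u" and "\<not> letter_le b z" by (cases w) auto
    then have zb: "letter_le z b"
      using letter_le_linear[of b z] low_letters_not_C less.prems by auto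
    have u: "u \<in> lists low_letters" "sorted_wrt letter_le u" "\<forall>y\<in>set u. letter_le z y" "z \<in> low_letters"
      using less.prems by (auto simp: w)
    obtain v where v: "v \<in> lists low_letters" "sorted_wrt letter_le v" "set v = insert b (set u)"
      "length v = Suc (length u)" "word (b # u) - word v \<in> pm.span (H \<union> sorted_words (length u))"
      using less.hyps[of u b] u less.prems w by auto
    let ?S = "pm.span (H \<union> sorted_words (length w))"
    have "word [z] \<star> (word (b # u) - word v) \<in> ?S"
      using stable[OF v(5) u(4)] w by simp
    then have 1: "word (z # b # u) - word (z # v) \<in> ?S"
      by (simp add: bilinear_ext_diff_right)
    have 2: "word (d # u) \<in> ?S" if d: "d \<in> Poly_Mapping.keys (w22_basis_bracket b z)" for d
    proof -
      have "d \<in> low_letters" by (rule low_letters_bracket[OF less.prems(3) u(4) d])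
      then obtain v' where v': "v' \<in> lists low_letters" "sorted_wrt letter_le v'"
        "length v' = Suc (length u)" "word (d # u) - word v' \<in> pm.span (H \<union> sorted_words (length u))"
        using less.hyps[of u d] u w by auto
      have "word v' \<in> ?S" using v' w by (intro pm.span_base) (auto intro!: sorted_wordsI)
      moreover have "word (d # u) - word v' \<in> ?S"
        by (rule span_sorted_mono[OF _ v'(4)]) (use w in simp)
      ultimately have "word (d # u) - word v' + word v' \<in> ?S" by (rule pm.span_add[rotated])
      then show ?thesis by simp
    qed
    let ?s = "\<Sum>d\<in>Poly_Mapping.keys (w22_basis_bracket b z).
        scale (Poly_Mapping.lookup (w22_basis_bracket b z) d) (word (d # u))"
    have "word (b # w) - word (z # v)
      = (word (b # z # u) - word (z # b # u) - ?s) + (word (z # b # u) - word (z # v)) + ?s"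
      by (simp add: w)
    also have "\<dots> \<in> ?S"
      using w22_ideal_swap[of b z u] H(2)
      by (intro pm.span_add pm.span_sum pm.span_scale 1 2) (auto intro: pm.span_base)
    finally show ?thesis
      using v u zb w by (intro exI[of _ "z # v"]) auto
  qed
qed

lemma low_word_span: "w \<in> lists low_letters \<Longrightarrow> word w \<in> pm.span (H \<union> (\<Union>n. sorted_words n))"
proof (induction w)
  case Nil
  show ?case by (intro pm.span_base) (auto intro!: sorted_wordsI)
next
  case (Cons b w)
  have "word [b] \<star> word w \<in> pm.span (H \<union> (\<Union>n. sorted_words n))"
  proof (rule tensor_mult_span[where S = "H \<union> (\<Union>n. sorted_words n)"])
    show "word w \<in> pm.span (H \<union> (\<Union>n. sorted_words n))" using Cons by simp
    fix s assume "s \<in> H \<union> (\<Union>n. sorted_words n)"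
    then show "word [b] \<star> s \<in> pm.span (H \<union> (\<Union>n. sorted_words n))"
    proof
      assume "s \<in> H"
      then show ?thesis using H(1) by (auto intro!: pm.span_base left_ideal_mult)
    next
      assume "s \<in> (\<Union>n. sorted_words n)"
      then obtain u where u: "s = word u" "u \<in> lists low_letters" "sorted_wrt letter_le u"
        unfolding sorted_words_def by blast
      obtain v where v: "v \<in> lists low_letters" "sorted_wrt letter_le v"
        "word (b # u) - word v \<in> pm.span (H \<union> sorted_words (length u))"
        using insert_sorted[of u b] u Cons.prems by auto
      have "word v \<in> pm.span (H \<union> (\<Union>n. sorted_words n))"
        using v by (intro pm.span_base) (auto intro!: sorted_wordsI)
      moreover have "word (b # u) - word v \<in> pm.span (H \<union> (\<Union>n. sorted_words n))"
        by (rule subsetD[OF pm.span_mono v(3)]) auto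
      ultimately have "word (b # u) - word v + word v \<in> pm.span (H \<union> (\<Union>n. sorted_words n))"
        by (rule pm.span_add[rotated])
      then show ?thesis using u(1) by simp
    qed
  qed
  then show ?case by simp
qed

end

text \<open>\<open>letter_le\<close> puts \<open>W\<close> before \<open>L\<close> and orders each
  kind by increasing index. The indices are negative, so their negatives decrease as in the
  monomials of the basis.\<close>

lemma sorted_low_word:
  "w \<in> lists low_letters \<Longrightarrow> sorted_wrt letter_le w \<Longrightarrow>
    \<exists>ms ns. decreasing ms \<and> decreasing ns \<and> w = pbw_word ms ns"
proof (induction w)
  case Nil
  show ?case by (intro exI[of _ "[]"]) (simp add: pbw_word_def)
next
  case (Cons b w)
  then obtain ms ns where w: "decreasing ms" "decreasing ns" "w = pbw_word ms ns" by auto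
  show ?case
  proof (cases b)
    case (L m)
    then have "ms = []" using Cons.prems(2) w(3) by (cases ms) (auto simp: pbw_word_def)
    moreover have "decreasing (- m # ns)"
      using Cons.prems L w by (force simp: pbw_word_def low_letters_def)
    ultimately show ?thesis
      using w L by (intro exI[of _ "[]"] exI[of _ "- m # ns"]) (auto simp: pbw_word_def)
  next
    case (W m)
    moreover have "decreasing (- m # ms)"
      using Cons.prems W w by (force simp: pbw_word_def low_letters_def)
    ultimately show ?thesis
      using w by (intro exI[of _ "- m # ms"] exI[of _ ns]) (auto simp: pbw_word_def)
  next
    case C
    then show ?thesis using Cons.prems by (auto simp: low_letters_def)
  qed
qed

section \<open>The vacuum ideal\<close>

definition verma_relations :: "complex \<Rightarrow> (w22_basis list \<Rightarrow>\<^sub>0 complex) set"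
  where "verma_relations c = {word [L m] |m. m \<ge> 0} \<union> {word [W m] |m. m \<ge> 0} \<union> {word [C] - scale c (word [])}"

lemma lower_app: "\<exists>w. \<forall>f. lower ms ns f = app (word w) f"
proof -
  have fold: "fold (\<lambda>m. act (X m)) ks f = acts (rev (map X ks)) f" for X and ks :: "int list" and f
    by (induction ks arbitrary: f) auto
  have "lower ms ns f = app (word (rev (map L ms) @ rev (map W ns))) f" for f
    by (simp add: lower_def fold)
  then show ?thesis by blast
qed

text \<open>Since the action is by right translation, this is the largest left ideal on which the
  vacuum functional vanishes, the analogue of the radical of a contravariant form.\<close>

definition annihilator :: "complex \<Rightarrow> (w22_basis list \<Rightarrow>\<^sub>0 complex) set"
  where "annihilator c = {x. app x (vac c) = 0}"

lemma left_ideal_annihilator: "left_ideal (annihilator c)"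
  by (simp add: left_ideal_def annihilator_def app_mult)

lemma vac_nonzero [simp]: "vac c \<noteq> 0"
proof
  assume "vac c = 0"
  then have "vac c [] = 0" by (simp add: zero_fun_apply)
  then show False by simp
qed

lemma annihilator_relations:
  "w22_ideal \<subseteq> annihilator c" "verma_relations c \<subseteq> annihilator c"
  "word [L (- 1)] \<in> annihilator c" "word [W (- 1)] \<in> annihilator c"
proof -
  have "act C (vac c) = fscale c (vac c)"
    using dual_act_C[OF vac_in_dual] by (simp add: fun_eq_iff fscale_apply)
  then show "w22_ideal \<subseteq> annihilator c" "verma_relations c \<subseteq> annihilator c"
    "word [L (- 1)] \<in> annihilator c" "word [W (- 1)] \<in> annihilator c"
    using app_w22_ideal[OF _ vac_in_dual]
    by (auto simp: annihilator_def verma_relations_def)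
qed

section \<open>Linear combinations of the monomials\<close>

definition pbw_index :: "(int list \<times> int list) set"
  where "pbw_index = {ms. decreasing ms} \<times> {ns. decreasing ns}"

definition pbw_sum :: "(int list \<times> int list \<Rightarrow> complex) \<Rightarrow> (int list \<times> int list) set \<Rightarrow> (w22_basis list \<Rightarrow>\<^sub>0 complex)"
  where "pbw_sum a X = (\<Sum>(ms, ns)\<in>X. scale (a (ms, ns)) (word (pbw_word ms ns)))"

lemma pbw_sum_update:
  assumes "finite X" "(ms, ns) \<in> X"
  shows "pbw_sum (a((ms, ns) := a (ms, ns) + r)) X = pbw_sum a X + scale r (word (pbw_word ms ns))"
proof -
  have "pbw_sum (a((ms, ns) := a (ms, ns) + r)) X = (\<Sum>q\<in>X.
      (case q of (ks, ls) \<Rightarrow> scale (a (ks, ls)) (word (pbw_word ks ls)))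
      + (if q = (ms, ns) then scale r (word (pbw_word ms ns)) else 0))"
    unfolding pbw_sum_def
    by (intro sum.cong refl) (auto simp: pm.scale_left_distrib simp del: scale_single split: if_splits)
  then show ?thesis using assms by (simp add: sum.distrib pbw_sum_def)
qed

text \<open>The element \<open>u\<close> is the lowering operator of the largest monomial that occurs.\<close>

lemma pbw_sum_lower:
  assumes "c \<noteq> 0" "finite X" "X \<subseteq> pbw_index" "p \<in> X" "a p \<noteq> 0"
  shows "\<exists>u. app (u \<star> pbw_sum a X) (vac c) = vac c"
proof -
  \<comment> \<open>The components are arranged as in \<open>lower_less\<close>, so that the
    lexicographic maximum is the monomial to be lowered to the vacuum.\<close>
  define key where "key = (\<lambda>(ms :: int list, ns :: int list). (length ns, ns, ms))"
  define Y where "Y = {q \<in> X. a q \<noteq> 0}"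
  have "p \<in> Y" using assms by (simp add: Y_def)
  then have Y: "finite Y" "Y \<noteq> {}" using assms(2) unfolding Y_def by (simp, blast)
  define m where "m = Max (key ` Y)"
  have "m \<in> key ` Y" unfolding m_def using Y by (intro Max_in) auto
  then obtain ms ns where q: "(ms, ns) \<in> Y" "m = (length ns, ns, ms)" by (auto simp: key_def)
  have less: "(length ls, ls, ks) < (length ns, ns, ms)" if "(ks, ls) \<in> Y" "(ks, ls) \<noteq> (ms, ns)" for ks ls
  proof -
    have "key (ks, ls) \<le> m" unfolding m_def using that Y by (intro Max_ge) auto
    then have "(length ls, ls, ks) \<le> (length ns, ns, ms)" by (simp only: q(2) key_def prod.case)
    moreover have "(length ls, ls, ks) \<noteq> (length ns, ns, ms)" using that by auto
    ultimately show ?thesis by (rule le_neq_trans)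
  qed
  have dec: "decreasing ms" "decreasing ns" using q assms(3) by (auto simp: Y_def pbw_index_def)
  obtain w where w: "lower ms ns f = app (word w) f" for f using lower_app by blast
  obtain r where r: "r \<noteq> 0" "lower ms ns (acts (pbw_word ms ns) (vac c)) = fscale r (vac c)"
    using lower_same[OF assms(1) dec] by blast
  have summand: "app (word w \<star> (case p of (ks, ls) \<Rightarrow> scale (a (ks, ls)) (word (pbw_word ks ls)))) (vac c)
      = (if p = (ms, ns) then fscale (a (ms, ns) * r) (vac c) else 0)" if "p \<in> X" for p
  proof (cases p)
    case (Pair ks ls)
    show ?thesis
    proof (cases "p = (ms, ns)")
      case True
      then show ?thesis using Pair r(2) w[symmetric]
        by (simp add: app_mult del: scale_single)
    next
      case False
      have "a p = 0 \<or> lower ms ns (acts (pbw_word ks ls) (vac c)) = 0"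
        using less[of ks ls] lower_less[OF assms(1) dec, of ks ls] that assms(3) Pair False
        by (auto simp: Y_def pbw_index_def)
      then have "fscale (a p) (app (word w) (acts (pbw_word ks ls) (vac c))) = 0"
        by (auto simp: w)
      then show ?thesis using False Pair by (auto simp: app_mult)
    qed
  qed
  have "app (word w \<star> pbw_sum a X) (vac c)
      = (\<Sum>p\<in>X. if p = (ms, ns) then fscale (a (ms, ns) * r) (vac c) else 0)"
    unfolding pbw_sum_def bilinear_ext_sum_right app_linear by (intro sum.cong refl summand)
  also have "\<dots> = fscale (a (ms, ns) * r) (vac c)"
    using q assms(2) by (simp add: Y_def)
  finally have "app (scale (inverse (a (ms, ns) * r)) (word w) \<star> pbw_sum a X) (vac c) = vac c"
    using q(1) r(1) by (simp add: bilinear_ext_scale_left Y_def field_simps del: scale_single)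
  then show ?thesis by blast
qed

text \<open>\<open>A\<close> plays the kernel of the map from the tensor algebra onto V(c,0,0),
  \<open>B\<close> the preimage of the submodule generated by the images of L_{-1} and W_{-1}. Their
  minimality is all that is used of the construction, so cosets do not enter.\<close>

locale vacuum_ideals =
  fixes c :: complex and A B :: "(w22_basis list \<Rightarrow>\<^sub>0 complex) set"
  assumes c_nonzero: "c \<noteq> 0"
    and A: "left_ideal A" "w22_ideal \<subseteq> A" "verma_relations c \<subseteq> A"
    and A_minimal: "\<And>N. left_ideal N \<Longrightarrow> w22_ideal \<subseteq> N \<Longrightarrow> verma_relations c \<subseteq> N \<Longrightarrow> A \<subseteq> N"
    and B: "left_ideal B" "A \<subseteq> B" "word [L (- 1)] \<in> B" "word [W (- 1)] \<in> B"
    and B_minimal: "\<And>N. left_ideal N \<Longrightarrow> A \<subseteq> N \<Longrightarrow> word [L (- 1)] \<in> N \<Longrightarrow> word [W (- 1)] \<in> N \<Longrightarrow> B \<subseteq> N"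
begin

lemma A_generators:
  "m \<ge> 0 \<Longrightarrow> word [L m] \<in> A" "m \<ge> 0 \<Longrightarrow> word [W m] \<in> A" "word [C] - scale c (word []) \<in> A"
  using A(3) unfolding verma_relations_def by blast+

lemma B_annihilator: "B \<subseteq> annihilator c"
  by (intro B_minimal A_minimal left_ideal_annihilator annihilator_relations)

lemma one_not_in_B: "word [] \<notin> B"
  using B_annihilator by (auto simp: annihilator_def)

text \<open>Modulo \<open>B\<close> every letter of index at least -1 is 0 or, in the case of
  \<open>C\<close>, the scalar \<open>c\<close>. Words in the letters that are left can be
  sorted.\<close>

lemma pbw_span: "\<exists>a X y. finite X \<and> X \<subseteq> pbw_index \<and> y \<in> B \<and> x = y + pbw_sum a X"
proof -
  let ?S = "pm.span (B \<union> (\<Union>n. sorted_words n))"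
  have non_low: "\<exists>r. word [b] - scale r (word []) \<in> B \<and> (basis_index b \<noteq> 0 \<longrightarrow> r = 0)"
    if "b \<notin> low_letters" for b
  proof (cases b)
    case (L m)
    then have "word [b] \<in> B"
      using that A_generators(1,2)[of m] B(2-4) by (cases "m = -1") (auto simp: low_letters_def)
    then show ?thesis by (intro exI[of _ 0]) simp
  next
    case (W m)
    then have "word [b] \<in> B"
      using that A_generators(1,2)[of m] B(2-4) by (cases "m = -1") (auto simp: low_letters_def)
    then show ?thesis by (intro exI[of _ 0]) simp
  next
    case C
    then show ?thesis using A_generators(3) B(2) by (intro exI[of _ c]) auto
  qed
  have IB: "w22_ideal \<subseteq> B" using A B by blast
  have "word w \<in> ?S" for w
  proof -
    have "word w \<in> pm.span (B \<union> weight_words low_letters (weight w))"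
      by (rule word_span[OF B(1) IB non_low])
    also have "\<dots> \<subseteq> ?S"
    proof (rule pm.span_minimal)
      show "B \<union> weight_words low_letters (weight w) \<subseteq> ?S"
      proof
        fix s assume "s \<in> B \<union> weight_words low_letters (weight w)"
        then show "s \<in> ?S"
        proof
          assume "s \<in> weight_words low_letters (weight w)"
          then obtain v where "v \<in> lists low_letters" "s = word v" unfolding weight_words_def by blast
          then show ?thesis using low_word_span[OF B(1) IB] by simp
        qed (auto intro: pm.span_base)
      qed
    qed simp
    finally show ?thesis .
  qed
  then have "x \<in> ?S"
    by (induction x rule: poly_mapping_linear_induct) (auto intro: pm.span_add pm.span_scale)
  then show ?thesis
  proof (induction rule: pm.span_induct_alt)
    case base
    show ?case
      by (intro exI[of _ "\<lambda>_. 0"] exI[of _ "{}"] exI[of _ 0])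
        (use B(1) in \<open>auto simp: left_ideal_def pbw_sum_def\<close>)
  next
    case (step r s x)
    then obtain a X y where x: "finite X" "X \<subseteq> pbw_index" "y \<in> B" "x = y + pbw_sum a X" by blast
    show ?case
    proof (cases "s \<in> B")
      case True
      then have "scale r s + y \<in> B"
        using x(3) left_ideal_subspace[OF B(1)] by (simp add: pm.subspace_add pm.subspace_scale)
      moreover have "scale r s + x = (scale r s + y) + pbw_sum a X" by (simp add: x(4) add.assoc)
      ultimately show ?thesis using x by blast
    next
      case False
      then obtain w where "w \<in> lists low_letters" "sorted_wrt letter_le w" "s = word w"
        using step by (auto simp: sorted_words_def)
      then obtain ms ns where s: "decreasing ms" "decreasing ns" "s = word (pbw_word ms ns)"
        using sorted_low_word by blast
      \<comment> \<open>Coefficients outside \<open>X\<close> are reset to 0, so that inserting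
        \<open>?p\<close> leaves the sum unchanged whether or not it already lies in
        \<open>X\<close>.\<close>
      let ?p = "(ms, ns)" and ?a = "\<lambda>q. if q \<in> X then a q else 0"
      have "pbw_sum a X = pbw_sum ?a (insert ?p X)"
        unfolding pbw_sum_def using x(1) by (intro sum.mono_neutral_cong_left) auto
      moreover have "pbw_sum (?a(?p := ?a ?p + r)) (insert ?p X)
          = pbw_sum ?a (insert ?p X) + scale r s"
        using pbw_sum_update[of "insert ?p X" ms ns ?a r] x(1) by (simp add: s(3) del: scale_single)
      ultimately have "scale r s + x = y + pbw_sum (?a(?p := ?a ?p + r)) (insert ?p X)"
        by (simp add: x(4) ac_simps)
      moreover have "finite (insert ?p X)" "insert ?p X \<subseteq> pbw_index"
        using x s by (auto simp: pbw_index_def)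
      ultimately show ?thesis using x(3) by blast
    qed
  qed
qed

lemma pbw_independent:
  assumes "finite X" "X \<subseteq> pbw_index" "pbw_sum a X \<in> B" "p \<in> X"
  shows "a p = 0"
proof (rule ccontr)
  assume "a p \<noteq> 0"
  then obtain u where "app (u \<star> pbw_sum a X) (vac c) = vac c"
    using pbw_sum_lower[OF c_nonzero assms(1,2,4)] by blast
  moreover have "app (pbw_sum a X) (vac c) = 0"
    using assms(3) B_annihilator by (auto simp: annihilator_def)
  ultimately show False by (simp add: app_mult)
qed

text \<open>An element of the annihilator is modulo \<open>B\<close> a combination of monomials that
  also kills the vacuum. A nonzero coefficient would allow lowering it to the vacuum, which is not
  0.\<close>

lemma B_eq_annihilator: "B = annihilator c"
proof
  show "annihilator c \<subseteq> B"
  proof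
    fix x assume x: "x \<in> annihilator c"
    obtain a X y where *: "finite X" "X \<subseteq> pbw_index" "y \<in> B" "x = y + pbw_sum a X"
      using pbw_span[of x] by (elim exE conjE) (rule that)
    have "app (pbw_sum a X) (vac c) = 0"
      using x * B_annihilator by (auto simp: annihilator_def)
    then have "a p = 0" if "p \<in> X" for p
      using pbw_sum_lower[OF c_nonzero *(1,2) that, of a] by (cases "a p = 0") (auto simp: app_mult)
    then have "pbw_sum a X = 0" unfolding pbw_sum_def by (intro sum.neutral) auto
    then show "x \<in> B" using * by simp
  qed
qed (rule B_annihilator)

lemma exists_lowering:
  assumes "x \<notin> B" shows "\<exists>u. u \<star> x - word [] \<in> B"
proof -
  obtain a X y where *: "finite X" "X \<subseteq> pbw_index" "y \<in> B" "x = y + pbw_sum a X"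
    using pbw_span[of x] by (elim exE conjE) (rule that)
  have "\<exists>p\<in>X. a p \<noteq> 0"
  proof (rule ccontr)
    assume "\<not> ?thesis"
    then have "pbw_sum a X = 0" unfolding pbw_sum_def by (intro sum.neutral) auto
    then show False using * assms by simp
  qed
  then obtain u where "app (u \<star> pbw_sum a X) (vac c) = vac c"
    using pbw_sum_lower[OF c_nonzero *(1,2), of _ a] by blast
  moreover have "app y (vac c) = 0" using *(3) B_annihilator by (auto simp: annihilator_def)
  ultimately have "u \<star> x - word [] \<in> annihilator c"
    by (simp add: annihilator_def *(4) app_mult)
  then show ?thesis using B_eq_annihilator by blast
qed

section \<open>Weights and the operator \<open>L 0\<close>\<close>

lemma A_subspace: "pm.subspace A"
  by (rule left_ideal_subspace[OF A(1)])

lemma L0_weight: "word [L 0] \<star> word w - scale (- of_int (weight w)) (word w) \<in> A"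
proof (induction w)
  case Nil
  show ?case using A_generators(1)[of 0] by simp
next
  case (Cons b w)
  have "w22_basis_bracket (L 0) b = Poly_Mapping.single b (- of_int (basis_index b))"
    by (cases b) (auto simp: w22_central_def)
  then have "(word [L 0, b] - word [b, L 0] - Poly_Mapping.single [b] (- of_int (basis_index b))) \<star> word w \<in> A"
    using w22_ideal_commutator[of "L 0" b] A(2) by (auto intro!: subsetD[OF A(2)] enveloping_ideal_right)
  moreover have "word [b] \<star> (word [L 0] \<star> word w - scale (- of_int (weight w)) (word w)) \<in> A"
    by (rule left_ideal_mult[OF A(1) Cons.IH])
  ultimately have "(word [L 0, b] - word [b, L 0] - Poly_Mapping.single [b] (- of_int (basis_index b))) \<star> word w
      + word [b] \<star> (word [L 0] \<star> word w - scale (- of_int (weight w)) (word w)) \<in> A"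
    by (rule pm.subspace_add[OF A_subspace])
  then show ?case
    by (simp add: bilinear_ext_diff_left bilinear_ext_diff_right tensor_bilinear single_diff single_add
        single_uminus algebra_simps)
qed

text \<open>The element \<open>u\<close> is the product of the factors \<open>L 0 + weight w\<close>
  over \<open>w\<close> in \<open>X\<close>. On a word \<open>v\<close> such a factor acts as
  \<open>weight w - weight v\<close>, so \<open>u\<close> kills \<open>X\<close> and multiplies the
  vacuum by the product \<open>r\<close> of nonzero weights.\<close>

lemma kill_weights:
  assumes "finite X" "\<And>w. w \<in> X \<Longrightarrow> weight w \<noteq> 0"
  shows "\<exists>u r. r \<noteq> 0 \<and> u - scale r (word []) \<in> A \<and> (\<forall>w\<in>X. u \<star> word w \<in> A)"
  using assms
proof (induction X)
  case empty
  show ?case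
    by (intro exI[of _ "word []"] exI[of _ 1]) (use A_subspace in \<open>auto simp: pm.subspace_0\<close>)
next
  case (insert w X)
  then obtain u r where u: "r \<noteq> 0" "u - scale r (word []) \<in> A" "\<forall>w\<in>X. u \<star> word w \<in> A" by auto
  define d :: complex where "d = of_int (weight w)"
  let ?v = "u \<star> (word [L 0] + scale d (word []))"
  have weight: "?v \<star> word v - scale (d - of_int (weight v)) (u \<star> word v) \<in> A" for v
    using left_ideal_mult[OF A(1) L0_weight[of v], of u]
    by (simp add: tensor_assoc tensor_bilinear bilinear_ext_diff_right pm.scale_left_diff_distrib
        pm.scale_left_distrib algebra_simps del: scale_single)
  show ?case
  proof (intro exI conjI ballI)
    show "d * r \<noteq> 0" using u(1) insert.prems by (simp add: d_def)
    have "?v - scale d u \<in> A" using weight[of "[]"] by simp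
    moreover have "scale d (u - scale r (word [])) \<in> A"
      by (rule pm.subspace_scale[OF A_subspace u(2)])
    ultimately have "?v - scale d u + scale d (u - scale r (word [])) \<in> A"
      by (rule pm.subspace_add[OF A_subspace])
    then show "?v - scale (d * r) (word []) \<in> A"
      by (simp add: pm.scale_right_diff_distrib)
  next
    fix v assume v: "v \<in> insert w X"
    have "scale (d - of_int (weight v)) (u \<star> word v) \<in> A"
    proof (cases "v \<in> X")
      case True
      then show ?thesis using u(3) pm.subspace_scale[OF A_subspace] by blast
    next
      case False
      then show ?thesis using v pm.subspace_0[OF A_subspace] by (simp add: d_def)
    qed
    from pm.subspace_add[OF A_subspace weight[of v] this] show "?v \<star> word v \<in> A" by simp
  qed
qed

text \<open>A word of weight 0 reduces modulo \<open>A\<close> to words of weight 0 in letters of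
  negative index, and the only such word is the empty one.\<close>

lemma weight_span: "\<exists>a z X. finite X \<and> (\<forall>w\<in>X. weight w \<noteq> 0) \<and>
    x - scale z (word []) - (\<Sum>w\<in>X. scale (a w) (word w)) \<in> A"
proof -
  define N where "N = {b. basis_index b < 0}"
  have non_neg: "\<exists>r. word [b] - scale r (word []) \<in> A \<and> (basis_index b \<noteq> 0 \<longrightarrow> r = 0)" if "b \<notin> N" for b
  proof (cases b)
    case C
    then show ?thesis using A_generators(3) by (intro exI[of _ c]) auto
  qed (use that A_generators in \<open>auto simp: N_def intro!: exI[of _ 0]\<close>)
  have zero: "w = []" if "w \<in> lists N" "weight w = 0" for w
  proof -
    have "weight w < 0 \<or> w = []" if "w \<in> lists N" for w
      using that by (induction w) (auto simp: N_def)
    then show ?thesis using that by fastforce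
  qed
  have weight_zero: "\<exists>z. word w - scale z (word []) \<in> A" if "weight w = 0" for w
  proof -
    have "word w \<in> pm.span (A \<union> weight_words N 0)"
      using word_span[OF A(1,2) non_neg, of N w] that by simp
    also have "\<dots> \<subseteq> pm.span (insert (word []) A)"
      using zero by (intro pm.span_mono) (auto simp: weight_words_def)
    finally show ?thesis
      unfolding pm.span_insert using left_ideal_span[OF A(1)] by simp
  qed
  define Z where "Z = {w \<in> Poly_Mapping.keys x. weight w = 0}"
  define X where "X = {w \<in> Poly_Mapping.keys x. weight w \<noteq> 0}"
  obtain f where f: "word w - scale (f w) (word []) \<in> A" if "w \<in> Z" for w
    using weight_zero unfolding Z_def by (metis (mono_tags, lifting) mem_Collect_eq)
  let ?a = "Poly_Mapping.lookup x"
  have alg: "x - t - q \<in> A" if "x = p + q" "s \<in> A" "s = p - t" for p q s t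
  proof -
    have "p + q - t - q = p - t" by (simp add: algebra_simps)
    then show ?thesis using that by simp
  qed
  have "x = (\<Sum>w\<in>Z. scale (?a w) (word w)) + (\<Sum>w\<in>X. scale (?a w) (word w))"
  proof -
    have "Poly_Mapping.keys x = Z \<union> X" "Z \<inter> X = {}" "finite Z" "finite X" by (auto simp: Z_def X_def)
    then show ?thesis
      by (subst (1) poly_mapping_expand) (simp add: sum.union_disjoint)
  qed
  moreover have "(\<Sum>w\<in>Z. scale (?a w) (word w - scale (f w) (word []))) \<in> A"
    by (intro pm.subspace_sum pm.subspace_scale A_subspace f)
  moreover have "(\<Sum>w\<in>Z. scale (?a w) (word w - scale (f w) (word [])))
      = (\<Sum>w\<in>Z. scale (?a w) (word w)) - scale (\<Sum>w\<in>Z. ?a w * f w) (word [])"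
    by (simp add: pm.scale_right_diff_distrib sum_subtractf pm.scale_sum_left del: scale_single)
  ultimately have "x - scale (\<Sum>w\<in>Z. ?a w * f w) (word []) - (\<Sum>w\<in>X. scale (?a w) (word w)) \<in> A"
    by (rule alg)
  moreover have "finite X" "\<forall>w\<in>X. weight w \<noteq> 0" by (auto simp: X_def)
  ultimately show ?thesis by blast
qed

text \<open>In contrast to \<open>exists_lowering\<close>, the congruence is modulo
  \<open>A\<close>: the vector of V(c,0,0) represented by \<open>x\<close> generates the highest
  weight vector itself, not just up to an element of J.\<close>

theorem exists_generator:
  assumes "x \<notin> B" shows "\<exists>u. u \<star> x - word [] \<in> A"
proof -
  obtain v where v: "v \<star> x - word [] \<in> B" using exists_lowering[OF assms] by blast
  define y where "y = v \<star> x - word []"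
  obtain a z X where X: "finite X" "\<forall>w\<in>X. weight w \<noteq> 0"
    and y: "y - scale z (word []) - (\<Sum>w\<in>X. scale (a w) (word w)) \<in> A"
    using weight_span[of y] by (elim exE conjE) (rule that)
  obtain u r where u: "r \<noteq> 0" "u - scale r (word []) \<in> A" "\<forall>w\<in>X. u \<star> word w \<in> A"
    using kill_weights[OF X(1)] X(2) by blast
  have "u \<star> (y - scale z (word []) - (\<Sum>w\<in>X. scale (a w) (word w))) \<in> A"
    by (rule left_ideal_mult[OF A(1) y])
  moreover have "(\<Sum>w\<in>X. scale (a w) (u \<star> word w)) \<in> A"
    using u(3) by (intro pm.subspace_sum pm.subspace_scale A_subspace) auto
  ultimately have "u \<star> (y - scale z (word []) - (\<Sum>w\<in>X. scale (a w) (word w)))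
      + (\<Sum>w\<in>X. scale (a w) (u \<star> word w)) \<in> A"
    by (rule pm.subspace_add[OF A_subspace])
  moreover have "u \<star> (\<Sum>w\<in>X. scale (a w) (word w)) = (\<Sum>w\<in>X. scale (a w) (u \<star> word w))"
    by (simp add: bilinear_ext_sum_right bilinear_ext_scale_right del: scale_single)
  moreover have "u \<star> scale z (word []) = scale z u"
    by (simp add: bilinear_ext_scale_right del: scale_single)
  ultimately have uy: "u \<star> y - scale z u \<in> A"
    by (simp add: bilinear_ext_diff_right del: scale_single)
  \<comment> \<open>The error \<open>y\<close> lies in \<open>B\<close>, hence so does
    \<open>u\<close> times \<open>y\<close>; modulo \<open>A\<close> this is the scalar
    \<open>z * r\<close>, while \<open>B\<close> does not contain 1.\<close>
  have "z = 0"
  proof (rule ccontr)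
    assume "z \<noteq> 0"
    note B_sub = left_ideal_subspace[OF B(1)]
    have 1: "u \<star> y \<in> B" using v B(1) by (simp add: y_def left_ideal_mult)
    have 2: "u \<star> y - scale z u \<in> B" using uy B(2) by blast
    have 3: "scale z (u - scale r (word [])) \<in> B"
      by (rule pm.subspace_scale[OF B_sub]) (use u(2) B(2) in blast)
    have "u \<star> y - (u \<star> y - scale z u) - scale z (u - scale r (word [])) \<in> B"
      by (rule pm.subspace_diff[OF B_sub pm.subspace_diff[OF B_sub 1 2] 3])
    then have "scale (z * r) (word []) \<in> B" by (simp add: pm.scale_right_diff_distrib)
    then have "scale (inverse (z * r)) (scale (z * r) (word [])) \<in> B"
      by (rule pm.subspace_scale[OF B_sub])
    then show False using one_not_in_B \<open>z \<noteq> 0\<close> u(1) by (simp add: field_simps)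
  qed
  then have "u \<star> y + (u - scale r (word [])) \<in> A"
    using uy u(2) by (auto intro: pm.subspace_add[OF A_subspace])
  then have "scale (inverse r) (u \<star> (v \<star> x) - scale r (word [])) \<in> A"
    by (intro pm.subspace_scale[OF A_subspace]) (simp add: y_def bilinear_ext_diff_right)
  then have "(scale (inverse r) (u \<star> v)) \<star> x - word [] \<in> A"
    using u(1) by (simp add: pm.scale_right_diff_distrib bilinear_ext_scale_left tensor_assoc)
  then show ?thesis by blast
qed

end

section \<open>Left modules and their quotients\<close>

locale left_module = R?: ring R + M?: abelian_group M
  for R :: "('r, 'n) ring_scheme" (structure) and M :: "('r, 'a, 'm) module_scheme" (structure) +
  assumes smult_closed [simp, intro]: "r \<in> carrier R \<Longrightarrow> x \<in> carrier M \<Longrightarrow> r \<odot>\<^bsub>M\<^esub> x \<in> carrier M"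
    and smult_l_distr: "r \<in> carrier R \<Longrightarrow> s \<in> carrier R \<Longrightarrow> x \<in> carrier M \<Longrightarrow>
      (r \<oplus> s) \<odot>\<^bsub>M\<^esub> x = r \<odot>\<^bsub>M\<^esub> x \<oplus>\<^bsub>M\<^esub> s \<odot>\<^bsub>M\<^esub> x"
    and smult_r_distr: "r \<in> carrier R \<Longrightarrow> x \<in> carrier M \<Longrightarrow> y \<in> carrier M \<Longrightarrow>
      r \<odot>\<^bsub>M\<^esub> (x \<oplus>\<^bsub>M\<^esub> y) = r \<odot>\<^bsub>M\<^esub> x \<oplus>\<^bsub>M\<^esub> r \<odot>\<^bsub>M\<^esub> y"
    and smult_assoc: "r \<in> carrier R \<Longrightarrow> s \<in> carrier R \<Longrightarrow> x \<in> carrier M \<Longrightarrow>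
      (r \<otimes> s) \<odot>\<^bsub>M\<^esub> x = r \<odot>\<^bsub>M\<^esub> (s \<odot>\<^bsub>M\<^esub> x)"
    and smult_one [simp]: "x \<in> carrier M \<Longrightarrow> \<one> \<odot>\<^bsub>M\<^esub> x = x"

lemma left_regular_simps [simp]:
  "carrier (left_regular R) = carrier R" "zero (left_regular R) = zero R" "add (left_regular R) = add R"
  "smult (left_regular R) = mult R"
  by (simp_all add: left_regular_def)

lemma left_module_left_regular:
  assumes "ring R" shows "left_module R (left_regular R)"
proof -
  interpret ring R by fact
  have "abelian_group (left_regular R)"
    by (rule abelian_groupI) (auto simp: a_ac intro!: bexI[of _ "\<ominus>\<^bsub>R\<^esub> x" for x] l_neg)
  then show ?thesis
    by (intro left_module.intro left_module_axioms.intro ring_axioms) (auto simp: l_distr r_distr m_assoc)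
qed

lemma quotient_module_simps [simp]:
  "carrier (quotient_module M N) = a_rcosets\<^bsub>M\<^esub> N" "zero (quotient_module M N) = N"
  "add (quotient_module M N) = set_add M"
  "r \<odot>\<^bsub>quotient_module M N\<^esub> X = (\<Union>x\<in>X. N +>\<^bsub>M\<^esub> (r \<odot>\<^bsub>M\<^esub> x))"
  by (simp_all add: quotient_module_def)

context left_module
begin

lemma submodule_abelian_subgroup:
  assumes "Module.submodule N R M" shows "abelian_subgroup N M"
  using assms by (intro abelian_subgroupI3 additive_subgroup.intro M.abelian_group_axioms)
    (simp add: Module.submodule_def)

lemma quotient_smult:
  assumes N: "Module.submodule N R M" and r: "r \<in> carrier R" and x: "x \<in> carrier M"
  shows "r \<odot>\<^bsub>quotient_module M N\<^esub> (N +>\<^bsub>M\<^esub> x) = N +>\<^bsub>M\<^esub> (r \<odot>\<^bsub>M\<^esub> x)"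
proof -
  interpret N: abelian_subgroup N M by (rule submodule_abelian_subgroup[OF N])
  have "N +>\<^bsub>M\<^esub> (r \<odot>\<^bsub>M\<^esub> y) = N +>\<^bsub>M\<^esub> (r \<odot>\<^bsub>M\<^esub> x)" if "y \<in> N +>\<^bsub>M\<^esub> x" for y
  proof -
    obtain n where n: "n \<in> N" "y = n \<oplus>\<^bsub>M\<^esub> x"
      using \<open>y \<in> N +>\<^bsub>M\<^esub> x\<close> by (auto simp: a_r_coset_def')
    then have "r \<odot>\<^bsub>M\<^esub> y = r \<odot>\<^bsub>M\<^esub> n \<oplus>\<^bsub>M\<^esub> r \<odot>\<^bsub>M\<^esub> x" "r \<odot>\<^bsub>M\<^esub> n \<in> N"
      using r x N.a_Hcarr Module.submodule.smult_closed[OF N] by (auto simp: smult_r_distr)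
    then have "r \<odot>\<^bsub>M\<^esub> y \<in> N +>\<^bsub>M\<^esub> (r \<odot>\<^bsub>M\<^esub> x)" by (auto simp: a_r_coset_def')
    then show ?thesis using N.a_repr_independence'[of "r \<odot>\<^bsub>M\<^esub> y" "r \<odot>\<^bsub>M\<^esub> x"] r x by simp
  qed
  moreover have "x \<in> N +>\<^bsub>M\<^esub> x" using x by (rule N.a_rcos_self)
  ultimately show ?thesis unfolding quotient_module_simps(4) by (intro UN_constant_eq) blast+
qed

lemma left_module_quotient:
  assumes N: "Module.submodule N R M"
  shows "left_module R (quotient_module M N)"
proof -
  interpret N: abelian_subgroup N M by (rule submodule_abelian_subgroup[OF N])
  have cosets: "X \<in> a_rcosets\<^bsub>M\<^esub> N \<longleftrightarrow> (\<exists>x\<in>carrier M. X = N +>\<^bsub>M\<^esub> x)" for X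
    by (auto simp: A_RCOSETS_def' a_r_coset_def')
  have ab: "abelian_group (quotient_module M N)"
  proof (rule abelian_groupI)
    fix X assume "X \<in> carrier (quotient_module M N)"
    then obtain x where x: "x \<in> carrier M" "X = N +>\<^bsub>M\<^esub> x" by (auto simp: cosets)
    show "\<exists>Y\<in>carrier (quotient_module M N). Y \<oplus>\<^bsub>quotient_module M N\<^esub> X = \<zero>\<^bsub>quotient_module M N\<^esub>"
      using x N.a_rcos_const[OF N.zero_closed]
      by (intro bexI[of _ "N +>\<^bsub>M\<^esub> (\<ominus>\<^bsub>M\<^esub> x)"]) (auto simp: cosets N.a_rcos_sum M.l_neg)
  qed (simp_all add: N.a_subgroup_in_rcosets N.rcosets_add_eq N.a_setmult_closed N.a_rcosets_assoc,
      auto simp: cosets N.a_rcos_sum M.a_comm)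
  show ?thesis
    by (intro left_module.intro left_module_axioms.intro R.ring_axioms ab)
      (auto simp: cosets quotient_smult[OF N] N.a_rcos_sum smult_l_distr smult_r_distr smult_assoc
        simp del: quotient_module_simps(4))
qed

end

section \<open>Cyclic modules over the enveloping algebra as quotients of the tensor algebra\<close>

definition env_proj :: "(w22_basis list \<Rightarrow>\<^sub>0 complex) \<Rightarrow> w22_env"
  where "env_proj x = w22_ideal +>\<^bsub>tensor_algebra\<^esub> x"

lemma ring_U: "ring U_w22"
  unfolding enveloping_algebra_def by (rule ideal.quotient_is_ring[OF ideal_enveloping_ideal])

lemma env_proj_hom: "ring_hom_ring tensor_algebra U_w22 env_proj"
  using ideal.rcos_ring_hom_ring[OF ideal_enveloping_ideal]
  unfolding enveloping_algebra_def env_proj_def[abs_def] .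

lemma env_proj_simps [simp]:
  "env_proj x \<in> carrier U_w22"
  "env_proj (x + y) = env_proj x \<oplus>\<^bsub>U_w22\<^esub> env_proj y"
  "env_proj (x - y) = env_proj x \<ominus>\<^bsub>U_w22\<^esub> env_proj y"
  "env_proj (x \<star> y) = env_proj x \<otimes>\<^bsub>U_w22\<^esub> env_proj y"
  "env_proj (word []) = \<one>\<^bsub>U_w22\<^esub>" "env_proj 0 = \<zero>\<^bsub>U_w22\<^esub>"
proof -
  interpret ring_hom_ring tensor_algebra U_w22 env_proj by (rule env_proj_hom)
  show "env_proj x \<in> carrier U_w22" using hom_closed[of x] by simp
  show *: "env_proj (x + y) = env_proj x \<oplus>\<^bsub>U_w22\<^esub> env_proj y" for x y using hom_add[of x y] by simp
  show "env_proj (x \<star> y) = env_proj x \<otimes>\<^bsub>U_w22\<^esub> env_proj y" using hom_mult[of x y] by simp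
  show "env_proj (word []) = \<one>\<^bsub>U_w22\<^esub>" "env_proj 0 = \<zero>\<^bsub>U_w22\<^esub>" using hom_one hom_zero by simp_all
  show "env_proj (x - y) = env_proj x \<ominus>\<^bsub>U_w22\<^esub> env_proj y"
    using hom_a_inv[of y] *[of x "- y"] by (simp add: a_minus_def)
qed

lemma range_env_proj: "range env_proj = carrier U_w22"
  by (auto simp: enveloping_algebra_def FactRing_def A_RCOSETS_def' env_proj_def a_r_coset_def')

lemma env_proj_eq_zero_iff: "env_proj x = \<zero>\<^bsub>U_w22\<^esub> \<longleftrightarrow> x \<in> w22_ideal"
proof -
  interpret ideal w22_ideal tensor_algebra by (rule ideal_enveloping_ideal)
  have "env_proj x = \<zero>\<^bsub>U_w22\<^esub> \<longleftrightarrow> w22_ideal +>\<^bsub>tensor_algebra\<^esub> x = w22_ideal"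
    by (simp add: enveloping_algebra_def FactRing_def env_proj_def)
  also have "\<dots> \<longleftrightarrow> x \<in> w22_ideal"
    using a_rcos_const[of x] a_rcos_self[of x] by auto
  finally show ?thesis .
qed

lemma env_gen_proj: "env_gen b = env_proj (word [b])"
  by (simp add: env_gen_def env_proj_def)

lemma env_scalar_proj: "env_scalar z = env_proj (scale z (word []))"
  by (simp add: env_scalar_def env_proj_def)

text \<open>A cyclic module presented as a quotient of the tensor algebra, with generator
  \<open>q (word [])\<close>. The enveloping algebra, the Verma module and the irreducible quotient
  are nested sets of cosets; along \<open>q\<close> their submodules become left ideals of one
  concrete algebra.\<close>

locale cover = left_module U_w22 M for M :: "(w22_env, 'a, 'm) module_scheme" (structure) +
  fixes q :: "(w22_basis list \<Rightarrow>\<^sub>0 complex) \<Rightarrow> 'a"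
  assumes range_q: "range q = carrier M"
    and q_add: "q (x + y) = q x \<oplus>\<^bsub>M\<^esub> q y"
    and q_mult: "q (u \<star> x) = env_proj u \<odot>\<^bsub>M\<^esub> q x"
begin

definition ker :: "(w22_basis list \<Rightarrow>\<^sub>0 complex) set"
  where "ker = {x. q x = \<zero>\<^bsub>M\<^esub>}"

lemma q_closed [simp]: "q x \<in> carrier M"
  using range_q by auto

lemma q_zero [simp]: "q 0 = \<zero>\<^bsub>M\<^esub>"
  using q_add[of 0 0] M.add.r_cancel_one'[of "q 0" "q 0"] by simp

lemma q_minus: "q (- x) = \<ominus>\<^bsub>M\<^esub> q x"
  using q_add[of "- x" x] M.minus_equality[of "q (- x)" "q x"] by simp

lemma q_eq_iff: "q x = q y \<longleftrightarrow> x - y \<in> ker"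
  using q_add[of x "- y"] M.r_neg[of "q y"] M.minus_equality[of "q x" "\<ominus>\<^bsub>M\<^esub> q y"]
  by (auto simp: ker_def q_minus)

lemma left_ideal_vimage:
  assumes "Module.submodule N U_w22 M" shows "left_ideal (q -` N)" "ker \<subseteq> q -` N"
proof -
  interpret N: abelian_subgroup N M by (rule submodule_abelian_subgroup[OF assms])
  show "left_ideal (q -` N)" using Module.submodule.smult_closed[OF assms]
    by (auto simp: left_ideal_def q_add q_mult)
  show "ker \<subseteq> q -` N" by (auto simp: ker_def)
qed

lemma submodule_image:
  assumes "left_ideal N" shows "Module.submodule (q ` N) U_w22 M"
proof (intro Module.submodule.intro submodule_axioms.intro)
  show "subgroup (q ` N) (add_monoid M)"
  proof (rule M.add.subgroupI)
    show "q ` N \<noteq> {}" using assms by (auto simp: left_ideal_def)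
  next
    fix a assume "a \<in> q ` N"
    then obtain x where "x \<in> N" "a = q x" by auto
    moreover have "- x \<in> N" using \<open>x \<in> N\<close> pm.subspace_neg[OF left_ideal_subspace[OF assms]] by simp
    ultimately show "\<ominus>\<^bsub>M\<^esub> a \<in> q ` N" by (auto simp flip: q_minus)
  next
    fix a b assume "a \<in> q ` N" "b \<in> q ` N"
    then show "a \<oplus>\<^bsub>M\<^esub> b \<in> q ` N" using assms by (auto simp: left_ideal_def simp flip: q_add)
  qed auto
next
  fix r a assume "r \<in> carrier U_w22" "a \<in> q ` N"
  then show "r \<odot>\<^bsub>M\<^esub> a \<in> q ` N"
    using assms by (auto simp: left_ideal_def simp flip: range_env_proj q_mult)
qed

lemma submodule_eq_image:
  assumes "Module.submodule N U_w22 M" shows "N = q ` (q -` N)"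
proof -
  interpret N: abelian_subgroup N M by (rule submodule_abelian_subgroup[OF assms])
  show ?thesis using N.a_subset range_q by auto
qed

lemma q_image_eq_iff:
  assumes "left_ideal N" "ker \<subseteq> N" shows "q x \<in> q ` N \<longleftrightarrow> x \<in> N"
proof
  assume "q x \<in> q ` N"
  then obtain y where "y \<in> N" "x - y \<in> ker" by (auto simp: q_eq_iff)
  then have "(x - y) + y \<in> N" using assms unfolding left_ideal_def by blast
  then show "x \<in> N" by simp
qed simp

lemma cover_quotient:
  assumes N: "Module.submodule N U_w22 M"
  shows "cover (quotient_module M N) (\<lambda>x. N +>\<^bsub>M\<^esub> q x)"
    and "cover.ker (quotient_module M N) (\<lambda>x. N +>\<^bsub>M\<^esub> q x) = q -` N"
proof -
  interpret N: abelian_subgroup N M by (rule submodule_abelian_subgroup[OF N])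
  interpret Q: left_module U_w22 "quotient_module M N" by (rule left_module_quotient[OF N])
  show *: "cover (quotient_module M N) (\<lambda>x. N +>\<^bsub>M\<^esub> q x)"
  proof (intro cover.intro[OF Q.left_module_axioms] cover_axioms.intro)
    have "range (\<lambda>x. N +>\<^bsub>M\<^esub> q x) = (\<lambda>m. N +>\<^bsub>M\<^esub> m) ` carrier M"
      by (simp add: image_image flip: range_q)
    then show "range (\<lambda>x. N +>\<^bsub>M\<^esub> q x) = carrier (quotient_module M N)"
      by (auto simp: A_RCOSETS_def' a_r_coset_def')
  next
    fix x y u
    show "N +>\<^bsub>M\<^esub> q (x + y) = (N +>\<^bsub>M\<^esub> q x) \<oplus>\<^bsub>quotient_module M N\<^esub> (N +>\<^bsub>M\<^esub> q y)"
      by (simp add: q_add N.a_rcos_sum)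
    show "N +>\<^bsub>M\<^esub> q (u \<star> x) = env_proj u \<odot>\<^bsub>quotient_module M N\<^esub> (N +>\<^bsub>M\<^esub> q x)"
      by (simp only: q_mult quotient_smult[OF N] env_proj_simps q_closed)
  qed
  have "N +>\<^bsub>M\<^esub> q x = N \<longleftrightarrow> q x \<in> N" for x
    using N.a_rcos_const[of "q x"] N.a_rcos_self[of "q x"] by auto
  then show "cover.ker (quotient_module M N) (\<lambda>x. N +>\<^bsub>M\<^esub> q x) = q -` N"
    unfolding cover.ker_def[OF *] by auto
qed

lemma gens_act_q: "gens_act M w (q x) = q (word w \<star> x)"
proof (induction w)
  case (Cons b w)
  have "word (b # w) \<star> x = word [b] \<star> (word w \<star> x)" by (simp flip: tensor_assoc)
  then show ?case using Cons by (simp add: gens_act_def env_gen_proj q_mult)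
qed (simp add: gens_act_def)

lemma cyclic_submodule_q: "cyclic_submodule U_w22 M (q x) = {q (u \<star> x) |u. True}"
  unfolding cyclic_submodule_def by (auto simp: q_mult simp flip: range_env_proj)

end

lemma cover_left_regular: "cover (left_regular U_w22) env_proj" "cover.ker (left_regular U_w22) env_proj = w22_ideal"
proof -
  interpret left_module U_w22 "left_regular U_w22" by (rule left_module_left_regular[OF ring_U])
  show *: "cover (left_regular U_w22) env_proj"
    by (intro cover.intro[OF left_module_axioms] cover_axioms.intro) (simp_all add: range_env_proj)
  show "cover.ker (left_regular U_w22) env_proj = w22_ideal"
    unfolding cover.ker_def[OF *] by (simp add: env_proj_eq_zero_iff)
qed

section \<open>The Verma module\<close>

definition verma_kernel :: "complex \<Rightarrow> (w22_basis list \<Rightarrow>\<^sub>0 complex) set"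
  where "verma_kernel c = \<Inter>{N. left_ideal N \<and> w22_ideal \<subseteq> N \<and> verma_relations c \<subseteq> N}"

lemma verma_kernel:
  "left_ideal (verma_kernel c)" "w22_ideal \<subseteq> verma_kernel c" "verma_relations c \<subseteq> verma_kernel c"
  "left_ideal N \<Longrightarrow> w22_ideal \<subseteq> N \<Longrightarrow> verma_relations c \<subseteq> N \<Longrightarrow> verma_kernel c \<subseteq> N"
  unfolding verma_kernel_def by (auto simp: left_ideal_def)

lemma verma_generators:
  "{env_gen (L m) | m. m > 0} \<union> {env_gen (W m) | m. m > 0} \<union>
     {env_gen C \<ominus>\<^bsub>U_w22\<^esub> env_scalar c,
      env_gen (L 0) \<ominus>\<^bsub>U_w22\<^esub> env_scalar 0,
      env_gen (W 0) \<ominus>\<^bsub>U_w22\<^esub> env_scalar 0} = env_proj ` verma_relations c"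
    (is "?G = _")
proof -
  have 0: "env_gen b \<ominus>\<^bsub>U_w22\<^esub> env_scalar 0 = env_proj (word [b])" for b
    using env_proj_simps(3)[of "word [b]" "scale 0 (word [])"]
    by (simp add: env_gen_proj env_scalar_proj del: env_proj_simps)
  have C: "env_gen C \<ominus>\<^bsub>U_w22\<^esub> env_scalar c = env_proj (word [C] - scale c (word []))"
    unfolding env_gen_proj env_scalar_proj env_proj_simps(3) ..
  have X: "{env_gen (X m) | m. m > 0} \<union> {env_proj (word [X 0])} = {env_proj (word [X m]) | m. m \<ge> 0}"
    for X :: "int \<Rightarrow> w22_basis"
    by (auto simp: env_gen_proj order_le_less)
  have union: "S \<union> T \<union> {x, y, z} = (S \<union> {y}) \<union> (T \<union> {z}) \<union> {x}" for S T and x y z :: w22_env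
    by auto
  have "?G = ({env_gen (L m) | m. m > 0} \<union> {env_proj (word [L 0])})
      \<union> ({env_gen (W m) | m. m > 0} \<union> {env_proj (word [W 0])}) \<union> {env_proj (word [C] - scale c (word []))}"
    unfolding 0 C by (rule union)
  also have "\<dots> = env_proj ` verma_relations c"
    unfolding X verma_relations_def image_Un by auto
  finally show ?thesis .
qed

lemma verma_ideal_eq: "verma_ideal c 0 0 = env_proj ` verma_kernel c"
proof -
  interpret cover "left_regular U_w22" env_proj by (rule cover_left_regular)
  have ker: "ker = w22_ideal" by (rule cover_left_regular)
  show ?thesis
    unfolding verma_ideal_def verma_generators left_ideal_gen_def
  proof (rule hull_unique)
    show "env_proj ` verma_relations c \<subseteq> env_proj ` verma_kernel c"
      using verma_kernel(3) by blast
    show "Module.submodule (env_proj ` verma_kernel c) U_w22 (left_regular U_w22)"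
      by (rule submodule_image[OF verma_kernel(1)])
    fix N assume N: "env_proj ` verma_relations c \<subseteq> N" "Module.submodule N U_w22 (left_regular U_w22)"
    have "verma_kernel c \<subseteq> env_proj -` N"
      using left_ideal_vimage[OF N(2)] N(1) unfolding ker by (intro verma_kernel) auto
    then show "env_proj ` verma_kernel c \<subseteq> N" by blast
  qed
qed

definition verma_proj :: "complex \<Rightarrow> (w22_basis list \<Rightarrow>\<^sub>0 complex) \<Rightarrow> w22_env set"
  where "verma_proj c x = verma_ideal c 0 0 +>\<^bsub>left_regular U_w22\<^esub> env_proj x"

lemma cover_verma:
  "cover (verma c 0 0) (verma_proj c)" "cover.ker (verma c 0 0) (verma_proj c) = verma_kernel c"
proof -
  interpret cover "left_regular U_w22" env_proj by (rule cover_left_regular)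
  have ker: "ker = w22_ideal" by (rule cover_left_regular)
  have N: "Module.submodule (verma_ideal c 0 0) U_w22 (left_regular U_w22)"
    unfolding verma_ideal_eq by (rule submodule_image[OF verma_kernel(1)])
  show "cover (verma c 0 0) (verma_proj c)"
    unfolding verma_def verma_proj_def[abs_def] by (rule cover_quotient[OF N])
  have "env_proj -` verma_ideal c 0 0 = verma_kernel c"
    unfolding verma_ideal_eq using q_image_eq_iff[OF verma_kernel(1)] verma_kernel(2) by (auto simp: ker)
  then show "cover.ker (verma c 0 0) (verma_proj c) = verma_kernel c"
    unfolding verma_def verma_proj_def[abs_def] cover_quotient(2)[OF N] .
qed

lemma verma_hwv_proj: "verma_hwv c 0 0 = verma_proj c (word [])"
  by (simp add: verma_hwv_def verma_proj_def)

text \<open>Written out as a sum so that its image is visibly the sum of the two cyclic submodules;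
  its minimality among left ideals is a separate step.\<close>

definition vacuum_kernel :: "complex \<Rightarrow> (w22_basis list \<Rightarrow>\<^sub>0 complex) set"
  where "vacuum_kernel c = {u \<star> word [L (- 1)] + v \<star> word [W (- 1)] + a |u v a. a \<in> verma_kernel c}"

lemma vacuum_kernelI:
  "x = u \<star> word [L (- 1)] + v \<star> word [W (- 1)] + a \<Longrightarrow> a \<in> verma_kernel c \<Longrightarrow> x \<in> vacuum_kernel c"
  unfolding vacuum_kernel_def by blast

lemma left_ideal_vacuum_kernel: "left_ideal (vacuum_kernel c)"
  unfolding left_ideal_def
proof (intro conjI ballI allI)
  note K = verma_kernel(1)[of c, unfolded left_ideal_def]
  show "0 \<in> vacuum_kernel c"
    by (rule vacuum_kernelI[of _ 0 0 0]) (use K in auto)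
  fix x y assume "x \<in> vacuum_kernel c"
  then obtain u v a where x: "x = u \<star> word [L (- 1)] + v \<star> word [W (- 1)] + a" "a \<in> verma_kernel c"
    unfolding vacuum_kernel_def by blast
  show "y \<star> x \<in> vacuum_kernel c"
    by (rule vacuum_kernelI[of _ "y \<star> u" "y \<star> v" "y \<star> a"])
      (use x K in \<open>auto simp: tensor_bilinear tensor_assoc\<close>)
  assume "y \<in> vacuum_kernel c"
  then obtain u' v' a' where y: "y = u' \<star> word [L (- 1)] + v' \<star> word [W (- 1)] + a'" "a' \<in> verma_kernel c"
    unfolding vacuum_kernel_def by blast
  show "x + y \<in> vacuum_kernel c"
    by (rule vacuum_kernelI[of _ "u + u'" "v + v'" "a + a'"])
      (use x y K in \<open>auto simp: tensor_bilinear ac_simps\<close>)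
qed

lemma vacuum_ideals: "c \<noteq> 0 \<Longrightarrow> vacuum_ideals c (verma_kernel c) (vacuum_kernel c)"
proof unfold_locales
  have zero: "0 \<in> verma_kernel c" using verma_kernel(1)[of c] by (simp add: left_ideal_def)
  show "verma_kernel c \<subseteq> vacuum_kernel c"
  proof
    fix x assume "x \<in> verma_kernel c"
    then show "x \<in> vacuum_kernel c" by (rule vacuum_kernelI[of _ 0 0, rotated]) simp
  qed
  show "word [L (- 1)] \<in> vacuum_kernel c"
    by (rule vacuum_kernelI[OF _ zero, of _ "word []" 0]) simp
  show "word [W (- 1)] \<in> vacuum_kernel c"
    by (rule vacuum_kernelI[OF _ zero, of _ 0 "word []"]) simp
  fix N assume "left_ideal N" "verma_kernel c \<subseteq> N" "word [L (- 1)] \<in> N" "word [W (- 1)] \<in> N"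
  then show "vacuum_kernel c \<subseteq> N" unfolding vacuum_kernel_def left_ideal_def by auto
qed (use verma_kernel left_ideal_vacuum_kernel in auto)

definition vacuum_submodule :: "complex \<Rightarrow> w22_env set set"
  where "vacuum_submodule c =
      cyclic_submodule U_w22 (verma c 0 0)
        (env_gen (L (- 1)) \<odot>\<^bsub>verma c 0 0\<^esub> verma_hwv c 0 0)
      <+>\<^bsub>verma c 0 0\<^esub>
      cyclic_submodule U_w22 (verma c 0 0)
        (env_gen (W (- 1)) \<odot>\<^bsub>verma c 0 0\<^esub> verma_hwv c 0 0)"

lemma vacuum_submodule_eq: "vacuum_submodule c = verma_proj c ` vacuum_kernel c"
proof -
  interpret cover "verma c 0 0" "verma_proj c" by (rule cover_verma)
  have ker: "ker = verma_kernel c" by (rule cover_verma)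
  have gen: "env_gen b \<odot>\<^bsub>verma c 0 0\<^esub> verma_hwv c 0 0 = verma_proj c (word [b])" for b
    using q_mult[of "word [b]" "word []"] by (simp add: verma_hwv_proj env_gen_proj)
  have absorb: "verma_proj c (u \<star> word [L (- 1)] + v \<star> word [W (- 1)] + a)
      = verma_proj c (u \<star> word [L (- 1)] + v \<star> word [W (- 1)])" if "a \<in> verma_kernel c" for u v a
    using that by (simp add: q_eq_iff ker)
  have zero: "0 \<in> verma_kernel c" using verma_kernel(1)[of c] by (simp add: left_ideal_def)
  have "vacuum_submodule c
      = {verma_proj c (u \<star> word [L (- 1)] + v \<star> word [W (- 1)]) |u v. True}"
    unfolding vacuum_submodule_def gen cyclic_submodule_q set_add_def' q_add by blast
  also have "\<dots> = verma_proj c ` vacuum_kernel c"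
  proof (intro equalityI subsetI)
    fix y assume "y \<in> {verma_proj c (u \<star> word [L (- 1)] + v \<star> word [W (- 1)]) |u v. True}"
    then obtain u v where "y = verma_proj c (u \<star> word [L (- 1)] + v \<star> word [W (- 1)])" by blast
    moreover have "u \<star> word [L (- 1)] + v \<star> word [W (- 1)] \<in> vacuum_kernel c"
      by (rule vacuum_kernelI[OF _ zero, of _ u v]) simp
    ultimately show "y \<in> verma_proj c ` vacuum_kernel c" by blast
  next
    fix y assume "y \<in> verma_proj c ` vacuum_kernel c"
    then obtain u v a where a: "y = verma_proj c (u \<star> word [L (- 1)] + v \<star> word [W (- 1)] + a)"
      "a \<in> verma_kernel c" unfolding vacuum_kernel_def by blast
    show "y \<in> {verma_proj c (u \<star> word [L (- 1)] + v \<star> word [W (- 1)]) |u v. True}"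
      unfolding a(1) absorb[OF a(2)] by blast
  qed
  finally show ?thesis .
qed

lemma vacuum_submodule:
  shows submodule_vacuum_submodule: "Module.submodule (vacuum_submodule c) U_w22 (verma c 0 0)"
    and vimage_vacuum_submodule: "c \<noteq> 0 \<Longrightarrow> verma_proj c -` vacuum_submodule c = vacuum_kernel c"
proof -
  interpret cover "verma c 0 0" "verma_proj c" by (rule cover_verma)
  have ker: "ker = verma_kernel c" by (rule cover_verma)
  show "Module.submodule (vacuum_submodule c) U_w22 (verma c 0 0)"
    unfolding vacuum_submodule_eq by (rule submodule_image[OF left_ideal_vacuum_kernel])
  assume "c \<noteq> 0"
  then interpret V: vacuum_ideals c "verma_kernel c" "vacuum_kernel c" by (rule vacuum_ideals)
  show "verma_proj c -` vacuum_submodule c = vacuum_kernel c"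
    unfolding vacuum_submodule_eq using q_image_eq_iff[OF left_ideal_vacuum_kernel] V.B(2)
    by (auto simp: ker)
qed

text \<open>A vector outside the candidate generates the highest weight vector by
  \<open>exists_generator\<close>, so a submodule containing it is everything.\<close>

lemma proper_submodule_subset:
  assumes "c \<noteq> 0" "Module.submodule N U_w22 (verma c 0 0)" "N \<noteq> carrier (verma c 0 0)"
  shows "N \<subseteq> vacuum_submodule c"
proof (rule ccontr)
  interpret cover "verma c 0 0" "verma_proj c" by (rule cover_verma)
  have ker: "ker = verma_kernel c" by (rule cover_verma)
  interpret V: vacuum_ideals c "verma_kernel c" "vacuum_kernel c" by (rule vacuum_ideals[OF assms(1)])
  note K = left_ideal_vimage[OF assms(2), unfolded ker]
  assume "\<not> N \<subseteq> vacuum_submodule c"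
  then obtain y where "y \<in> N" "y \<notin> vacuum_submodule c" by blast
  moreover from \<open>y \<in> N\<close> obtain x where "y = verma_proj c x"
    using submodule_eq_image[OF assms(2)] by blast
  ultimately have "verma_proj c x \<in> N" "verma_proj c x \<notin> vacuum_submodule c" by simp_all
  then have "x \<notin> vacuum_kernel c" unfolding vacuum_submodule_eq by blast
  then obtain u where u: "u \<star> x - word [] \<in> verma_kernel c" using V.exists_generator by blast
  have ux: "u \<star> x \<in> verma_proj c -` N"
    using \<open>verma_proj c x \<in> N\<close> by (intro left_ideal_mult[OF K(1)]) simp
  have "u \<star> x - (u \<star> x - word []) \<in> verma_proj c -` N"
    by (rule pm.subspace_diff[OF left_ideal_subspace[OF K(1)] ux subsetD[OF K(2) u]])
  then have "word [] \<in> verma_proj c -` N" by simp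
  then have "y \<in> verma_proj c -` N" for y
    using left_ideal_mult[OF K(1), of "word []" y] by simp
  then have "carrier (verma c 0 0) \<subseteq> N" unfolding range_q[symmetric] by auto
  moreover have "N \<subseteq> carrier (verma c 0 0)"
    by (subst submodule_eq_image[OF assms(2)]) auto
  ultimately show False using assms(3) by (simp add: subset_antisym)
qed

text \<open>Containing all proper submodules gives both halves of the description: the candidate is
  maximal, and any other maximal submodule lies in it and therefore equals it.\<close>

lemma verma_max_eq:
  assumes "c \<noteq> 0" shows "verma_max c 0 0 = vacuum_submodule c"
proof -
  interpret cover "verma c 0 0" "verma_proj c" by (rule cover_verma)
  interpret V: vacuum_ideals c "verma_kernel c" "vacuum_kernel c" by (rule vacuum_ideals[OF assms])
  have proper: "vacuum_submodule c \<noteq> carrier (verma c 0 0)"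
    using V.one_not_in_B vimage_vacuum_submodule[OF assms] q_closed[of "word []"] by auto
  note sub = proper_submodule_subset[OF assms]
  have "maximal_proper_submodule U_w22 (verma c 0 0) (vacuum_submodule c)"
    unfolding maximal_proper_submodule_def
    using submodule_vacuum_submodule proper sub by blast
  moreover have "J = vacuum_submodule c" if "maximal_proper_submodule U_w22 (verma c 0 0) J" for J
    using that submodule_vacuum_submodule[of c] proper sub[of J]
    unfolding maximal_proper_submodule_def by blast
  ultimately show ?thesis unfolding verma_max_def by (rule the_equality)
qed

section \<open>The irreducible quotient\<close>

definition irred_proj :: "complex \<Rightarrow> (w22_basis list \<Rightarrow>\<^sub>0 complex) \<Rightarrow> w22_env set set"
  where "irred_proj c x = vacuum_submodule c +>\<^bsub>verma c 0 0\<^esub> verma_proj c x"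

lemma cover_irred:
  assumes "c \<noteq> 0"
  shows "cover (irred c 0 0) (irred_proj c)" "cover.ker (irred c 0 0) (irred_proj c) = vacuum_kernel c"
proof -
  interpret cover "verma c 0 0" "verma_proj c" by (rule cover_verma)
  show "cover (irred c 0 0) (irred_proj c)" "cover.ker (irred c 0 0) (irred_proj c) = vacuum_kernel c"
    unfolding irred_def irred_proj_def[abs_def] verma_max_eq[OF assms]
    using cover_quotient[OF submodule_vacuum_submodule] vimage_vacuum_submodule[OF assms] by simp_all
qed

lemma irred_monomial_proj:
  assumes "c \<noteq> 0" shows "irred_monomial c 0 0 ms ns = irred_proj c (word (pbw_word ms ns))"
proof -
  interpret cover "irred c 0 0" "irred_proj c" by (rule cover_irred[OF assms])
  have "irred_hwv c 0 0 = irred_proj c (word [])"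
    by (simp add: irred_hwv_def irred_proj_def verma_max_eq[OF assms] verma_hwv_proj)
  then show ?thesis by (simp add: irred_monomial_def gens_act_q pbw_word_def)
qed

section \<open>The complex vector space underlying a quotient, and the basis\<close>

context cover
begin

lemma complex_space_smult: "z \<odot>\<^bsub>complex_space M\<^esub> q x = q (scale z x)"
  using q_mult[of "scale z (word [])" x]
  by (simp add: complex_space_def env_scalar_proj)

lemma complex_space_simps [simp]:
  "carrier (complex_space M) = carrier M" "zero (complex_space M) = \<zero>\<^bsub>M\<^esub>" "add (complex_space M) = add M"
  by (simp_all add: complex_space_def)

lemma vectorspace_complex_space: "vectorspace class_ring (complex_space M)"
proof -
  have carrier: "v \<in> carrier M \<longleftrightarrow> (\<exists>x. v = q x)" for v using range_q by auto
  have "abelian_group (complex_space M)"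
    by (rule abelian_groupI) (auto simp: M.a_ac intro!: bexI[of _ "\<ominus>\<^bsub>M\<^esub> x" for x] M.l_neg)
  moreover have "field (class_ring :: complex ring)" by (rule class_field.field_axioms)
  moreover from this have "cring (class_ring :: complex ring)" by (rule fieldE)
  ultimately show ?thesis
    by (intro vectorspace.intro moduleI)
      (auto simp: carrier complex_space_smult pm.scale_left_distrib pm.scale_right_distrib simp flip: q_add)
qed

text \<open>Linear combinations run over sets of vectors, whereas the monomials form a family
  indexed by pairs; injectivity of \<open>f\<close> translates between the two.\<close>

lemma finsum_q:
  assumes "finite X" "inj_on f X" "\<And>p. p \<in> X \<Longrightarrow> f p = q (g p)"
  shows "finsum (complex_space M) (\<lambda>v. a v \<odot>\<^bsub>complex_space M\<^esub> v) (f ` X) = q (\<Sum>p\<in>X. scale (a (f p)) (g p))"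
proof -
  interpret vectorspace class_ring "complex_space M" by (rule vectorspace_complex_space)
  show ?thesis
    using assms
  proof (induction X)
    case empty
    have "finsum (complex_space M) (\<lambda>v. a v \<odot>\<^bsub>complex_space M\<^esub> v) {} = \<zero>\<^bsub>complex_space M\<^esub>"
      by (rule finsum_empty)
    then show ?case by simp
  next
    case (insert p X)
    have "finsum (complex_space M) (\<lambda>v. a v \<odot>\<^bsub>complex_space M\<^esub> v) (insert (f p) (f ` X))
        = (a (f p) \<odot>\<^bsub>complex_space M\<^esub> f p)
          \<oplus>\<^bsub>complex_space M\<^esub> finsum (complex_space M) (\<lambda>v. a v \<odot>\<^bsub>complex_space M\<^esub> v) (f ` X)"
      using insert by (intro finsum_insert) (auto simp: complex_space_smult)
    also have "\<dots> = q (scale (a (f p)) (g p) + (\<Sum>p\<in>X. scale (a (f p)) (g p)))"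
      using insert by (simp add: complex_space_smult q_add)
    finally show ?case using insert by simp
  qed
qed

end

lemma decreasing_gt1_eq: "decreasing_gt1 = {ms. decreasing ms}"
  by (simp add: decreasing_gt1_def decreasing_def)

lemma inj_on_irred_monomial:
  assumes "c \<noteq> 0" shows "inj_on (\<lambda>(ms, ns). irred_monomial c 0 0 ms ns) pbw_index"
proof (rule inj_onI, rule ccontr)
  interpret cover "irred c 0 0" "irred_proj c" by (rule cover_irred[OF assms])
  interpret V: vacuum_ideals c "verma_kernel c" "vacuum_kernel c" by (rule vacuum_ideals[OF assms])
  fix p p' assume p: "p \<in> pbw_index" "p' \<in> pbw_index" "p \<noteq> p'"
    and eq: "(case p of (ms, ns) \<Rightarrow> irred_monomial c 0 0 ms ns) = (case p' of (ms, ns) \<Rightarrow> irred_monomial c 0 0 ms ns)"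
  \<comment> \<open>Two distinct indices with equal vectors would give the vanishing combination
    with coefficients 1 and -1.\<close>
  define a :: "int list \<times> int list \<Rightarrow> complex" where "a = (\<lambda>q. if q = p then 1 else - 1)"
  have "pbw_sum a {p, p'} = word (pbw_word (fst p) (snd p)) - word (pbw_word (fst p') (snd p'))"
    using p(3) by (simp add: pbw_sum_def a_def split_beta single_uminus)
  moreover have "word (pbw_word (fst p) (snd p)) - word (pbw_word (fst p') (snd p')) \<in> vacuum_kernel c"
    using eq by (simp add: irred_monomial_proj[OF assms] split_beta q_eq_iff cover_irred(2)[OF assms])
  ultimately have "a p = 0"
    using p by (intro V.pbw_independent[of "{p, p'}"]) auto
  then show False by (simp add: a_def)
qed

lemma basis_irred_monomial:
  assumes "c \<noteq> 0"
  shows "vectorspace.basis class_ring (complex_space (irred c 0 0))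
    ((\<lambda>(ms, ns). irred_monomial c 0 0 ms ns) ` pbw_index)"
proof -
  interpret cover "irred c 0 0" "irred_proj c" by (rule cover_irred[OF assms])
  have ker: "ker = vacuum_kernel c" by (rule cover_irred[OF assms])
  interpret V: vacuum_ideals c "verma_kernel c" "vacuum_kernel c" by (rule vacuum_ideals[OF assms])
  interpret E: vectorspace class_ring "complex_space (irred c 0 0)" by (rule vectorspace_complex_space)
  define f where "f = (\<lambda>(ms, ns). irred_monomial c 0 0 ms ns)"
  define g where "g = (\<lambda>(ms, ns). word (pbw_word ms ns))"
  have fg: "f p = irred_proj c (g p)" for p
    by (simp add: f_def g_def irred_monomial_proj[OF assms] split_beta)
  have inj: "inj_on f pbw_index" unfolding f_def by (rule inj_on_irred_monomial[OF assms])
  have lincomb: "E.lincomb a (f ` X) = irred_proj c (pbw_sum (\<lambda>p. a (f p)) X)"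
    if "finite X" "X \<subseteq> pbw_index" for a X
    using finsum_q[OF that(1) inj_on_subset[OF inj that(2)] fg]
    by (simp add: E.lincomb_def pbw_sum_def g_def split_beta)
  have "\<not> E.lin_dep (f ` pbw_index)"
  proof
    assume "E.lin_dep (f ` pbw_index)"
    then obtain F a v where F: "finite F" "F \<subseteq> f ` pbw_index" "v \<in> F" "a v \<noteq> 0"
      and zero: "E.lincomb a F = \<zero>\<^bsub>complex_space (irred c 0 0)\<^esub>"
      unfolding E.lin_dep_def by auto
    obtain X where X: "X \<subseteq> pbw_index" "finite X" "F = f ` X"
      using finite_subset_image[OF F(1,2)] by blast
    then obtain p where p: "p \<in> X" "v = f p" using F(3) by auto
    have "pbw_sum (\<lambda>p. a (f p)) X \<in> vacuum_kernel c"
      using zero lincomb[OF X(2,1)] X(3) by (simp add: ker_def flip: ker)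
    then have "a (f p) = 0" using V.pbw_independent[OF X(2,1)] p(1) by blast
    then show False using F(4) p(2) by simp
  qed
  moreover have "v \<in> E.span (f ` pbw_index)" if v: "v \<in> carrier (irred c 0 0)" for v
  proof -
    obtain x where x: "v = irred_proj c x" using v range_q by auto
    obtain a X y where X: "finite X" "X \<subseteq> pbw_index" "y \<in> vacuum_kernel c" "x = y + pbw_sum a X"
      using V.pbw_span[of x] by (elim exE conjE) (rule that)
    \<comment> \<open>The coefficients are carried from indices over to vectors, which is possible
      because \<open>f\<close> is injective on \<open>pbw_index\<close>.\<close>
    define b where "b = (\<lambda>v. a (inv_into pbw_index f v))"
    have "pbw_sum (\<lambda>p. b (f p)) X = pbw_sum a X"
      unfolding pbw_sum_def using X(2) inv_into_f_f[OF inj]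
      by (intro sum.cong) (auto simp: b_def subset_iff)
    then have "v = E.lincomb b (f ` X)"
      using X by (simp add: lincomb x q_eq_iff ker)
    moreover have "finite (f ` X)" "f ` X \<subseteq> f ` pbw_index" "b \<in> f ` X \<rightarrow> carrier class_ring"
      using X(1,2) by auto
    ultimately show ?thesis unfolding E.span_def mem_Collect_eq by (intro exI conjI)
  qed
  moreover have sub: "f ` pbw_index \<subseteq> carrier (irred c 0 0)" unfolding fg by auto
  moreover have "E.span (f ` pbw_index) \<subseteq> carrier (irred c 0 0)"
    using E.span_closed[of "f ` pbw_index"] sub by auto
  ultimately show ?thesis
    unfolding E.basis_def f_def[symmetric] by auto
qed

text \<open>Injectivity is asserted along with the basis property because a set of vectors does not
  record that different pairs of sequences give different monomials.\<close>

theorem theorem2p1: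
  fixes c :: complex
  assumes "c \<noteq> 0"
  shows "verma_max c 0 0 =
      cyclic_submodule U_w22 (verma c 0 0)
        (env_gen (L (- 1)) \<odot>\<^bsub>verma c 0 0\<^esub> verma_hwv c 0 0)
      <+>\<^bsub>verma c 0 0\<^esub>
      cyclic_submodule U_w22 (verma c 0 0)
        (env_gen (W (- 1)) \<odot>\<^bsub>verma c 0 0\<^esub> verma_hwv c 0 0)
    \<and> inj_on (\<lambda>(ms, ns). irred_monomial c 0 0 ms ns) (decreasing_gt1 \<times> decreasing_gt1)
    \<and> vectorspace.basis class_ring (complex_space (irred c 0 0))
        {irred_monomial c 0 0 ms ns | ms ns. ms \<in> decreasing_gt1 \<and> ns \<in> decreasing_gt1}"
proof -
  have index: "pbw_index = decreasing_gt1 \<times> decreasing_gt1"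
    by (simp add: pbw_index_def decreasing_gt1_eq)
  have "(\<lambda>(ms, ns). irred_monomial c 0 0 ms ns) ` pbw_index
      = {irred_monomial c 0 0 ms ns | ms ns. ms \<in> decreasing_gt1 \<and> ns \<in> decreasing_gt1}"
    unfolding index by auto
  then show ?thesis
    using verma_max_eq[OF assms] inj_on_irred_monomial[OF assms] basis_irred_monomial[OF assms]
    unfolding vacuum_submodule_def index by simp
qed

end
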